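(* Let $\mathbb{X}=\ell_\infty^3$ and let $\mathbb{Y}$ be a two-dimensional Banach space. Let $x_1=(1,1,1)$, $x_2=(-1,1,1)$, $x_3=(-1,-1,1)$, $x_4=(1,-1,1)$. Let $T\in\mathbb{L}(\mathbb{X},\mathbb{Y})$ with $\|T\|=1$ be such that $M_T\cap\operatorname{Ext}(B_{\mathbb{X}})=\{\pm x_1,\pm x_2,\pm x_3,\pm x_4\}$, and let $S_1=\{x_i:1\leq i\leq 4,\ Tx_i\text{ is a smooth point of }S_{\mathbb{Y}}\}$. Then: (I) Suppose $|S_1|=4$. (a) If either $\operatorname{Rank}(T)=1$, or for each $i,j$ with $1\leq i\neq j\leq 4$, either $Tx_i,Tx_j$ or $Tx_i,-Tx_j$ belong to the same straight line segment contained in $S_{\mathbb{Y}}$, then $T$ is $3$-smooth. (b) Otherwise, $T$ is $4$-smooth. (II) If $|S_1|=3$, then $T$ is $4$-smooth. (III) If $|S_1|=2$, then $T$ is $5$-smooth. (IV) If $|S_1|<2$, then $S_1=\emptyset$ and $T$ is $6$-smooth.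
   Context: $\mathbb{L}(\mathbb{X},\mathbb{Y})$ is the space of linear operators with the operator norm. $B_{\mathbb{X}}$ is the closed unit ball, $S_{\mathbb{Y}}$ the unit sphere, $\operatorname{Ext}$ denotes the set of extreme points, and $M_T=\{x\in S_{\mathbb{X}}:\|Tx\|=\|T\|\}$. For a Banach space $\mathbb{Z}$ and $z\in S_{\mathbb{Z}}$, $J(z)=\{f\in \mathbb{Z}^*:\|f\|=1,\ f(z)=1\}$; $z$ is smooth if $J(z)$ is a singleton, and $k$-smooth if $\dim\operatorname{span} J(z)=k$ ($T$ being considered in the unit sphere of $\mathbb{L}(\mathbb{X},\mathbb{Y})$). *)

theory Defs
  imports "HOL-Analysis.Analysis" "HOL-Library.Function_Algebras"
begin

(* Pointwise real vector space structure on functions, so that spans and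
   dimensions of sets of functionals can be taken with the library's dim/span. *)
instantiation "fun" :: (type, real_vector) real_vector
begin
definition scaleR_fun :: "real \<Rightarrow> ('a \<Rightarrow> 'b) \<Rightarrow> 'a \<Rightarrow> 'b"
  where "scaleR_fun c f = (\<lambda>x. c *\<^sub>R f x)"
instance
  by standard (auto simp: scaleR_fun_def fun_eq_iff scaleR_add_right scaleR_add_left)
end

definition supnorm :: "real^3 \<Rightarrow> real" where
  "supnorm x = Max (range (\<lambda>i. \<bar>x $ i\<bar>))"

definition ballX :: "(real^3) set" where
  "ballX = {x. supnorm x \<le> 1}"

definition ExtBX :: "(real^3) set" where
  "ExtBX = {x. x extreme_point_of ballX}"

definition opnormX :: "(real^3 \<Rightarrow> 'b::real_normed_vector) \<Rightarrow> real" where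
  "opnormX T = Sup {norm (T x) | x. supnorm x \<le> 1}"

definition MT :: "(real^3 \<Rightarrow> 'b::real_normed_vector) \<Rightarrow> (real^3) set" where
  "MT T = {x. supnorm x = 1 \<and> norm (T x) = opnormX T}"

definition JY :: "'b::real_normed_vector \<Rightarrow> ('b \<Rightarrow> real) set" where
  "JY y = {f. linear f \<and> onorm f = 1 \<and> f y = 1}"

definition smooth_pt :: "'b::real_normed_vector \<Rightarrow> bool" where
  "smooth_pt y \<longleftrightarrow> (\<exists>f. JY y = {f})"

(* linear functionals on L(X,Y); represented as functions on all maps
   real^3 => 'b that are linear on the linear maps and vanish off them *)
definition op_functional :: "((real^3 \<Rightarrow> 'b::real_normed_vector) \<Rightarrow> real) \<Rightarrow> bool" where
  "op_functional \<Phi> \<longleftrightarrow>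
     (\<forall>A B. linear A \<longrightarrow> linear B \<longrightarrow> \<Phi> (A + B) = \<Phi> A + \<Phi> B) \<and>
     (\<forall>c A. linear A \<longrightarrow> \<Phi> (c *\<^sub>R A) = c * \<Phi> A) \<and>
     (\<forall>A. \<not> linear A \<longrightarrow> \<Phi> A = 0)"

definition op_dual_norm :: "((real^3 \<Rightarrow> 'b::real_normed_vector) \<Rightarrow> real) \<Rightarrow> real" where
  "op_dual_norm \<Phi> = Sup {\<bar>\<Phi> A\<bar> | A. linear A \<and> opnormX A \<le> 1}"

definition JL :: "(real^3 \<Rightarrow> 'b::real_normed_vector) \<Rightarrow> ((real^3 \<Rightarrow> 'b) \<Rightarrow> real) set" where
  "JL T = {\<Phi>. op_functional \<Phi> \<and> op_dual_norm \<Phi> = 1 \<and> \<Phi> T = 1}"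

definition k_smooth :: "nat \<Rightarrow> (real^3 \<Rightarrow> 'b::real_normed_vector) \<Rightarrow> bool" where
  "k_smooth k T \<longleftrightarrow> dim (span (JL T)) = k"

definition xpt :: "nat \<Rightarrow> real^3" where
  "xpt i = (if i = 1 then vector [1, 1, 1] else if i = 2 then vector [-1, 1, 1]
            else if i = 3 then vector [-1, -1, 1] else vector [1, -1, 1])"

definition S1 :: "(real^3 \<Rightarrow> 'b::real_normed_vector) \<Rightarrow> (real^3) set" where
  "S1 T = {xpt i | i. i \<in> {1..4} \<and> smooth_pt (T (xpt i))}"

definition same_segment :: "'b::real_normed_vector \<Rightarrow> 'b \<Rightarrow> bool" where
  "same_segment u v \<longleftrightarrow>
     (\<exists>a b. closed_segment a b \<subseteq> sphere 0 1 \<and> u \<in> closed_segment a b \<and> v \<in> closed_segment a b)"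

end

theory Submission
  imports Defs
begin

text \<open>
  Every functional on \<open>L(X, Y)\<close> has the form \<open>A \<mapsto> f (A x) + g (A x')\<close> for a fixed basis
  \<open>f, g\<close> of the dual of \<open>Y\<close>. By a first-order expansion of the operator norm at \<open>T\<close>, the
  span of \<open>J(T)\<close> is spanned by the functionals \<open>A \<mapsto> h (A x\<^sub>i)\<close> with \<open>h \<in> J(T x\<^sub>i)\<close>. If
  every span of \<open>J(T x\<^sub>i)\<close> is spanned by a subset of \<open>{f, g}\<close>, the order of smoothness is
  therefore the dimension of the span of those \<open>x\<^sub>i\<close> whose span contains \<open>f\<close> plus the same
  number for \<open>g\<close>.

  Since \<open>x\<^sub>1 + x\<^sub>3 = x\<^sub>2 + x\<^sub>4\<close>, the images of the vertices form a parallelogram of unit vectors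
  in a plane. Either some nonzero \<open>f\<close> lies in all four spans, and the order is \<open>3\<close> plus the
  dimension of the span of the vertices with nonsmooth image, or all images are smooth and
  coincide in pairs up to sign, and the order is \<open>2 + 2\<close>.
\<close>

section \<open>Support functionals in a normed plane\<close>

text \<open>The type is only a real vector space, so \<open>dim\<close> supplies just a two-element
  spanning set; the exchange bound forbids a third independent vector.\<close>

lemma plane_decomp:
  fixes y z :: "'b::real_vector"
  assumes dim2: "dim (UNIV :: 'b set) = 2" and y: "y \<noteq> 0" and z: "z \<notin> span {y}"
  obtains s t where "x = s *\<^sub>R y + t *\<^sub>R z"
proof -
  obtain B :: "'b set" where B: "independent B" "UNIV \<subseteq> span B" "card B = 2"
    using basis_exists[of "UNIV :: 'b set"] dim2 by metis
  then have finB: "finite B"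
    by (metis card.infinite zero_neq_numeral)
  have ind: "independent {z, y}"
    using y z by (simp add: independent_insert)
  have "x \<in> span {z, y}"
  proof (rule ccontr)
    assume "x \<notin> span {z, y}"
    then have "independent {x, z, y}" "x \<notin> {z, y}"
      using ind by (auto simp: independent_insert intro: span_base)
    then have "card {x, z, y} \<le> card B"
      using independent_span_bound[OF finB] B(2) by blast
    moreover have "card {x, z, y} = 3"
      using \<open>x \<notin> {z, y}\<close> z by (auto simp: card_insert_if span_base)
    ultimately show False
      using B(3) by simp
  qed
  then obtain t where "x - t *\<^sub>R z \<in> span {y}"
    by (auto simp: span_breakdown_eq)
  then obtain s where "x - t *\<^sub>R z = s *\<^sub>R y"
    by (auto simp: span_singleton)
  then have "x = s *\<^sub>R y + t *\<^sub>R z"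
    by (simp add: algebra_simps)
  then show ?thesis ..
qed

lemma plane_second_vector:
  fixes y :: "'b::real_vector"
  assumes dim2: "dim (UNIV :: 'b set) = 2"
  obtains z where "z \<notin> span {y}"
proof -
  have "\<not> UNIV \<subseteq> span {y}"
  proof
    assume "UNIV \<subseteq> span {y}"
    then have "dim (UNIV :: 'b set) \<le> card {y}"
      by (intro dim_le_card) auto
    then show False
      using dim2 by simp
  qed
  then show ?thesis
    using that by blast
qed

text \<open>
  The value \<open>f z\<close> of the functional is the right derivative of the norm at \<open>y\<close> in
  direction \<open>z\<close>, the largest value compatible with \<open>\<bar>f x\<bar> \<le> norm x\<close>.
\<close>

lemma extremal_support_functional_aux:
  fixes y z :: "'b::real_normed_vector"
  assumes dim2: "dim (UNIV :: 'b set) = 2" and y: "norm y = 1" and z: "z \<notin> span {y}"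
  obtains f where "linear f" "\<And>x. \<bar>f x\<bar> \<le> norm x" "f y = 1"
    "\<And>e. e > 0 \<Longrightarrow> \<forall>\<^sub>F s in at_top. norm (s *\<^sub>R y + z) \<le> s + f z + e"
proof -
  \<comment> \<open>By the triangle inequality \<open>\<phi>\<close> is nonincreasing, so its
    infimum \<open>\<alpha>\<close> is its limit at infinity, the one-sided derivative of the norm
    at \<open>y\<close> along \<open>z\<close>.\<close>
  define \<phi> where "\<phi> s = norm (s *\<^sub>R y + z) - s" for s
  define \<alpha> where "\<alpha> = (INF s. \<phi> s)"
  have lower: "- s' - norm (s' *\<^sub>R y + z) \<le> \<phi> s" for s s'
  proof -
    have "(s - s') *\<^sub>R y = (s *\<^sub>R y + z) - (s' *\<^sub>R y + z)"
      by (simp add: algebra_simps)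
    then have "\<bar>s - s'\<bar> \<le> norm (s *\<^sub>R y + z) + norm (s' *\<^sub>R y + z)"
      by (metis norm_triangle_ineq4 norm_scaleR y mult.right_neutral)
    then show ?thesis
      by (simp add: \<phi>_def)
  qed
  then have bdd: "bdd_below (range \<phi>)"
    by (intro bdd_belowI2)
  have \<alpha>_le: "\<alpha> \<le> \<phi> s" for s
    unfolding \<alpha>_def by (rule cINF_lower[OF bdd]) simp
  have \<alpha>_ge: "- s - norm (s *\<^sub>R y + z) \<le> \<alpha>" for s
    unfolding \<alpha>_def by (rule cINF_greatest) (auto intro: lower)
  \<comment> \<open>This is the required bound on the vectors \<open>s *\<^sub>R y + z\<close>, with
    \<open>\<alpha>\<close> as the value at \<open>z\<close>; homogeneity carries it to the whole
    plane.\<close>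
  have bnd: "\<bar>s + \<alpha>\<bar> \<le> norm (s *\<^sub>R y + z)" for s
    using \<alpha>_le[of s] \<alpha>_ge[of s] by (simp add: \<phi>_def)
  have "y \<noteq> 0"
    using y by auto
  have "z \<noteq> y"
    using z span_base by auto
  have "independent {z, y}"
    using \<open>y \<noteq> 0\<close> z by (simp add: independent_insert)
  from linear_independent_extend[OF this, of "\<lambda>x. if x = y then 1 else \<alpha>"]
  obtain f where f: "linear f" "f y = 1" "f z = \<alpha>"
    using \<open>z \<noteq> y\<close> by auto
  have "\<bar>f x\<bar> \<le> norm x" for x
  proof -
    obtain s t where x: "x = s *\<^sub>R y + t *\<^sub>R z"
      using plane_decomp[OF dim2 \<open>y \<noteq> 0\<close> z] .
    have fx: "f x = s + t * \<alpha>"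
      using f by (simp add: x linear_add linear_scale)
    show ?thesis
    proof (cases "t = 0")
      case True
      then show ?thesis
        using fx y by (simp add: x)
    next
      case False
      then have "f x = t * (s / t + \<alpha>)"
        by (simp add: fx field_simps)
      moreover have "norm x = \<bar>t\<bar> * norm ((s / t) *\<^sub>R y + z)"
      proof -
        have "x = t *\<^sub>R ((s / t) *\<^sub>R y + z)"
          using False by (simp add: x scaleR_add_right)
        then show ?thesis
          by (metis norm_scaleR)
      qed
      ultimately show ?thesis
        using bnd[of "s / t"] by (simp add: abs_mult mult_left_mono)
    qed
  qed
  moreover have "\<forall>\<^sub>F s in at_top. norm (s *\<^sub>R y + z) \<le> s + f z + e" if e: "e > 0" for e
  proof -
    have "(INF s. \<phi> s) < \<alpha> + e"
      using e by (simp add: \<alpha>_def)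
    then obtain s0 where s0: "\<phi> s0 < \<alpha> + e"
      using cINF_less_iff[OF UNIV_not_empty bdd] by blast
    have "norm (s *\<^sub>R y + z) \<le> s + f z + e" if "s \<ge> s0" for s
    proof -
      have "s *\<^sub>R y + z = (s0 *\<^sub>R y + z) + (s - s0) *\<^sub>R y"
        by (simp add: algebra_simps)
      then have "norm (s *\<^sub>R y + z) \<le> norm (s0 *\<^sub>R y + z) + (s - s0)"
        using that y by (metis norm_triangle_ineq norm_scaleR mult.right_neutral abs_of_nonneg diff_ge_0_iff_ge)
      then show ?thesis
        using s0 by (simp add: f \<phi>_def)
    qed
    then show ?thesis
      using eventually_at_top_linorder by blast
  qed
  ultimately show ?thesis
    using f that by blast
qed

text \<open>In a direction \<open>h = t *\<^sub>R y\<close> every supporting functional at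
  \<open>y\<close> has \<open>f h = t\<close>, and the norm is exactly \<open>s + t\<close> once
  \<open>s \<ge> - t\<close>; all other directions are already covered.\<close>

lemma extremal_support_functional:
  fixes y h :: "'b::real_normed_vector"
  assumes dim2: "dim (UNIV :: 'b set) = 2" and y: "norm y = 1"
  obtains f where "linear f" "\<And>x. \<bar>f x\<bar> \<le> norm x" "f y = 1"
    "\<And>e. e > 0 \<Longrightarrow> \<forall>\<^sub>F s in at_top. norm (s *\<^sub>R y + h) \<le> s + f h + e"
proof (cases "h \<in> span {y}")
  case False
  then show ?thesis
    using extremal_support_functional_aux[OF dim2 y False] that by blast
next
  case True
  then obtain t where t: "h = t *\<^sub>R y"
    by (auto simp: span_singleton)
  obtain z where "z \<notin> span {y}"
    using plane_second_vector[OF dim2] .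
  then obtain f where f: "linear f" "\<And>x. \<bar>f x\<bar> \<le> norm x" "f y = 1"
    using extremal_support_functional_aux[OF dim2 y] by blast
  have "\<forall>\<^sub>F s in at_top. norm (s *\<^sub>R y + h) \<le> s + f h + e" if "e > 0" for e
  proof (rule eventually_mono[OF eventually_ge_at_top[of "- t"]])
    fix s assume "- t \<le> s"
    then show "norm (s *\<^sub>R y + h) \<le> s + f h + e"
      using that f y by (simp add: t linear_scale flip: scaleR_add_left)
  qed
  then show ?thesis
    using f that by blast
qed

text \<open>Split the plane into the line through \<open>y\<close> and the kernel of a functional
  \<open>g\<close> that supports the norm at \<open>y\<close>: the first coordinate of
  \<open>x\<close> is \<open>g x\<close>, and the triangle inequality then bounds the
  second.\<close>

lemma linear_functional_bounded:
  fixes f :: "'b::real_normed_vector \<Rightarrow> real"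
  assumes dim2: "dim (UNIV :: 'b set) = 2" and f: "linear f"
  shows "bounded_linear f"
proof -
  obtain y0 :: 'b where "y0 \<noteq> 0"
    using plane_second_vector[OF dim2, of 0] by auto
  define y where "y = y0 /\<^sub>R norm y0"
  have y: "norm y = 1"
    using \<open>y0 \<noteq> 0\<close> by (simp add: y_def)
  then have "y \<noteq> 0"
    by auto
  obtain g where g: "linear g" "\<And>x. \<bar>g x\<bar> \<le> norm x" "g y = 1"
    using extremal_support_functional[OF dim2 y] by metis
  obtain z where z: "z \<notin> span {y}"
    using plane_second_vector[OF dim2] .
  define w where "w = z - g z *\<^sub>R y"
  have w: "w \<notin> span {y}"
  proof
    assume "w \<in> span {y}"
    then have "w + g z *\<^sub>R y \<in> span {y}"
      by (rule span_add) (simp add: span_base span_scale)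
    then show False
      using z by (simp add: w_def)
  qed
  have "g w = 0" "w \<noteq> 0"
    using g w by (auto simp: w_def linear_diff linear_scale span_zero)
  have "\<bar>f x\<bar> \<le> norm x * (\<bar>f y\<bar> + 2 * \<bar>f w\<bar> / norm w)" for x
  proof -
    obtain s t where x: "x = s *\<^sub>R y + t *\<^sub>R w"
      using plane_decomp[OF dim2 \<open>y \<noteq> 0\<close> w] .
    have "g x = s"
      using g \<open>g w = 0\<close> by (simp add: x linear_add linear_scale)
    then have s: "\<bar>s\<bar> \<le> norm x"
      using g(2) by blast
    have "\<bar>t\<bar> * norm w = norm (x - s *\<^sub>R y)"
      by (simp add: x)
    also have "\<dots> \<le> norm x + \<bar>s\<bar>"
      using norm_triangle_ineq4[of x "s *\<^sub>R y"] y by simp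
    finally have t: "\<bar>t\<bar> \<le> 2 * norm x / norm w"
      using s \<open>w \<noteq> 0\<close> by (simp add: field_simps)
    have "\<bar>f x\<bar> \<le> \<bar>s\<bar> * \<bar>f y\<bar> + \<bar>t\<bar> * \<bar>f w\<bar>"
      using f abs_triangle_ineq[of "s * f y" "t * f w"] by (simp add: x linear_add linear_scale abs_mult)
    also have "\<dots> \<le> norm x * \<bar>f y\<bar> + (2 * norm x / norm w) * \<bar>f w\<bar>"
      using s t by (intro add_mono mult_right_mono) auto
    finally show ?thesis
      by (simp add: algebra_simps)
  qed
  then show ?thesis
    using f by (auto simp: bounded_linear_def bounded_linear_axioms_def linear_iff)
qed

text \<open>The pointwise form avoids \<open>onorm\<close>, a supremum that controls values only for
  bounded maps; in the plane every linear functional is bounded.\<close>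

lemma JY_iff:
  fixes y :: "'b::real_normed_vector"
  assumes dim2: "dim (UNIV :: 'b set) = 2" and y: "norm y = 1"
  shows "f \<in> JY y \<longleftrightarrow> linear f \<and> (\<forall>x. \<bar>f x\<bar> \<le> norm x) \<and> f y = 1"
proof
  assume f: "f \<in> JY y"
  then have "bounded_linear f"
    using linear_functional_bounded[OF dim2] by (simp add: JY_def)
  then show "linear f \<and> (\<forall>x. \<bar>f x\<bar> \<le> norm x) \<and> f y = 1"
    using f onorm[of f] by (simp add: JY_def)
next
  assume f: "linear f \<and> (\<forall>x. \<bar>f x\<bar> \<le> norm x) \<and> f y = 1"
  then have "bounded_linear f"
    using linear_functional_bounded[OF dim2] by simp
  then have "1 \<le> onorm f"
    using onorm[of f y] f y by simp
  moreover have "onorm f \<le> 1"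
    using f by (intro onorm_bound) auto
  ultimately show "f \<in> JY y"
    using f by (simp add: JY_def)
qed

section \<open>Smooth points and parallelograms of unit vectors\<close>

lemma linear_functional_eqI:
  fixes f g :: "'b::real_vector \<Rightarrow> real"
  assumes dim2: "dim (UNIV :: 'b set) = 2" and "linear f" "linear g"
    and y: "y \<noteq> 0" and z: "z \<notin> span {y}" and eq: "f y = g y" "f z = g z"
  shows "f = g"
proof
  fix x
  obtain s t where "x = s *\<^sub>R y + t *\<^sub>R z"
    using plane_decomp[OF dim2 y z] .
  then show "f x = g x"
    using assms by (simp add: linear_add linear_scale)
qed

lemma JY_nonempty:
  fixes y :: "'b::real_normed_vector"
  assumes dim2: "dim (UNIV :: 'b set) = 2" and y: "norm y = 1"
  obtains f where "f \<in> JY y"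
  using extremal_support_functional[OF dim2 y] JY_iff[OF dim2 y] by metis

lemma JY_minus: "f \<in> JY (- y) \<longleftrightarrow> - f \<in> JY y"
proof -
  have "linear (- f) \<longleftrightarrow> linear f" for f :: "'a \<Rightarrow> real"
  proof -
    have "linear (- g)" if "linear g" for g :: "'a \<Rightarrow> real"
      using linear_compose_neg[OF that] by (simp add: fun_Compl_def)
    from this[of f] this[of "- f"] show ?thesis
      by auto
  qed
  moreover have "onorm (- f) = onorm f"
    using onorm_neg[of f] by (simp add: fun_Compl_def)
  moreover have "f (- y) = 1 \<longleftrightarrow> (- f) y = 1" if "linear f"
    using linear_neg[OF that, of y] by simp
  ultimately show ?thesis
    by (auto simp: JY_def)
qed

lemma JY_minus_image: "JY (- y) = uminus ` JY y"
proof
  show "JY (- y) \<subseteq> uminus ` JY y"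
  proof
    fix f assume "f \<in> JY (- y)"
    then show "f \<in> uminus ` JY y"
      by (intro image_eqI[of _ _ "- f"]) (simp_all add: JY_minus)
  qed
  show "uminus ` JY y \<subseteq> JY (- y)"
    by (auto simp: JY_minus)
qed

text \<open>Spans are insensitive to sign, so an image vector may be exchanged with its
  negative.\<close>

lemma span_JY_minus [simp]: "span (JY (- y)) = span (JY y)"
proof -
  have "span (JY (- y)) \<subseteq> span (JY y)" for y :: 'a
    by (rule span_minimal) (auto simp: JY_minus_image intro: span_base span_neg)
  from this[of y] this[of "- y"] show ?thesis
    by auto
qed

lemma smooth_pt_minus [simp]: "smooth_pt (- y) \<longleftrightarrow> smooth_pt y"
proof -
  have "smooth_pt (- y)" if "smooth_pt y" for y :: 'a
    using that by (auto simp: smooth_pt_def JY_minus_image)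
  from this[of y] this[of "- y"] show ?thesis
    by auto
qed

lemma linear_of_span_JY:
  assumes "f \<in> span (JY y)"
  shows "linear f"
  using assms
proof (induction rule: span_induct_alt)
  case base
  show ?case
    by (simp add: linear_iff)
next
  case (step c x z)
  then show ?case
    by (auto simp: JY_def linear_iff scaleR_fun_def algebra_simps)
qed

text \<open>Two distinct supporting functionals agree at \<open>y\<close> and differ elsewhere, so
  they form a basis of the dual of the plane.\<close>

lemma nonsmooth_span_JY:
  fixes y :: "'b::real_normed_vector"
  assumes dim2: "dim (UNIV :: 'b set) = 2" and y: "norm y = 1" and ns: "\<not> smooth_pt y"
    and h: "linear h"
  shows "h \<in> span (JY y)"
proof -
  obtain f where f: "f \<in> JY y"
    using JY_nonempty[OF dim2 y] .
  then obtain g where g: "g \<in> JY y" "g \<noteq> f"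
    using ns by (auto simp: smooth_pt_def)
  then obtain z where z: "f z \<noteq> g z"
    by (metis ext)
  have lin: "linear f" "linear g" "f y = 1" "g y = 1"
    using f g by (auto simp: JY_def)
  have "y \<noteq> 0"
    using y by auto
  have "z \<notin> span {y}"
    using z lin by (auto simp: span_singleton linear_scale)
  \<comment> \<open>Both functionals are 1 at \<open>y\<close>, so the coefficients must sum to
    \<open>h y\<close>; \<open>\<beta>\<close> is then solved from the values at
    \<open>z\<close>.\<close>
  define \<beta> where "\<beta> = (h z - h y * f z) / (g z - f z)"
  have "\<beta> * (g z - f z) = h z - h y * f z"
    using z by (simp add: \<beta>_def)
  then have "h z = (h y - \<beta>) * f z + \<beta> * g z"
    by (simp add: algebra_simps)
  moreover have "linear ((h y - \<beta>) *\<^sub>R f + \<beta> *\<^sub>R g)"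
    using lin by (auto simp: linear_iff scaleR_fun_def algebra_simps)
  ultimately have "h = (h y - \<beta>) *\<^sub>R f + \<beta> *\<^sub>R g"
    using lin h by (intro linear_functional_eqI[OF dim2 _ _ \<open>y \<noteq> 0\<close> \<open>z \<notin> span {y}\<close>])
      (auto simp: scaleR_fun_def)
  moreover have "(h y - \<beta>) *\<^sub>R f + \<beta> *\<^sub>R g \<in> span (JY y)"
    using f g by (intro span_add span_scale span_base)
  ultimately show ?thesis
    by simp
qed

text \<open>A functional supporting an interior point of a segment is at most 1 at the endpoints,
  hence equal to 1 at both. Distinct endpoints with this property are independent, so these values
  determine it.\<close>

lemma smooth_between:
  fixes p q r :: "'b::real_normed_vector"
  assumes dim2: "dim (UNIV :: 'b set) = 2"
    and unit: "norm p = 1" "norm q = 1" "norm r = 1" and "q \<noteq> r"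
    and p: "p = (1 - t) *\<^sub>R q + t *\<^sub>R r" and t: "0 < t" "t < 1"
  shows "smooth_pt p"
proof -
  have ends: "f q = 1 \<and> f r = 1" if "f \<in> JY p" for f
  proof -
    have f: "linear f" "\<And>x. \<bar>f x\<bar> \<le> norm x" "f p = 1"
      using that JY_iff[OF dim2 unit(1)] by auto
    have le: "f q \<le> 1" "f r \<le> 1"
      using f(2)[of q] f(2)[of r] unit by auto
    have eq: "(1 - t) * (1 - f q) + t * (1 - f r) = 0"
    proof -
      have "(1 - t) * f q + t * f r = 1"
        using f by (simp only: p linear_add linear_scale real_scaleR_def)
      then show ?thesis
        by (simp add: algebra_simps)
    qed
    have "0 \<le> (1 - t) * (1 - f q)" "0 \<le> t * (1 - f r)"
      using le t by simp_all
    then have "(1 - t) * (1 - f q) = 0" "t * (1 - f r) = 0"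
      using eq by linarith+
    then show ?thesis
      using t by simp
  qed
  obtain f where f: "f \<in> JY p"
    using JY_nonempty[OF dim2 unit(1)] .
  have "q \<noteq> 0"
    using unit by auto
  have "r \<notin> span {q}"
  proof
    assume "r \<in> span {q}"
    then obtain c where c: "r = c *\<^sub>R q"
      by (auto simp: span_singleton)
    then have "f r = c * f q"
      using f by (simp add: JY_def linear_scale)
    then show False
      using ends[OF f] c \<open>q \<noteq> r\<close> by simp
  qed
  have "g = f" if "g \<in> JY p" for g
    using that f ends[OF f] ends[OF that]
    by (intro linear_functional_eqI[OF dim2 _ _ \<open>q \<noteq> 0\<close> \<open>r \<notin> span {q}\<close>]) (auto simp: JY_def)
  then show ?thesis
    using f by (auto simp: smooth_pt_def)
qed

text \<open>All four points lie on a line missing the origin, and \<open>w\<close> is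
  \<open>q\<close> shifted by \<open>r - p\<close>. A nonzero shift places \<open>p\<close> strictly
  between \<open>q\<close> and \<open>r\<close>, or \<open>q\<close> strictly between
  \<open>p\<close> and \<open>w\<close>, making a nonsmooth point smooth; so \<open>w\<close>
  coincides with \<open>q\<close>, or with \<open>r\<close> when \<open>q = p\<close>.\<close>

lemma collinear_nonsmooth:
  fixes p q r w :: "'b::real_normed_vector"
  assumes dim2: "dim (UNIV :: 'b set) = 2"
    and unit: "norm p = 1" "norm q = 1" "norm r = 1" "norm w = 1"
    and f: "linear f" "f p = e" "f q = e" "f r = e" "e \<noteq> (0::real)"
    and sum: "p + w = q + r"
    and ns: "\<not> smooth_pt p" "\<not> smooth_pt q" "\<not> smooth_pt r"
  shows "\<not> smooth_pt w"
proof (cases "q = p")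
  case True
  then show ?thesis
    using sum ns by simp
next
  case False
  have "q - p \<notin> span {p}"
  proof
    assume "q - p \<in> span {p}"
    then obtain c where c: "q - p = c *\<^sub>R p"
      by (auto simp: span_singleton)
    have "f (q - p) = c * f p"
      unfolding c using f(1) by (simp add: linear_scale)
    then have "c = 0"
      using f by (simp add: linear_diff)
    then show False
      using c False by simp
  qed
  moreover have "p \<noteq> 0"
    using unit by auto
  ultimately obtain \<alpha> t where r0: "r - p = \<alpha> *\<^sub>R p + t *\<^sub>R (q - p)"
    using plane_decomp[OF dim2] by metis
  have "f (r - p) = \<alpha> * f p + t * f (q - p)"
    unfolding r0 using f(1) by (simp add: linear_add linear_scale)
  then have "\<alpha> = 0"
    using f by (simp add: linear_diff)
  then have r: "r = p + t *\<^sub>R (q - p)"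
    using r0 by (simp add: algebra_simps)
  have w: "w = q + t *\<^sub>R (q - p)"
    using sum r by (simp add: algebra_simps)
  consider "t = 0" | "t < 0" | "t > 0"
    by linarith
  then show ?thesis
  proof cases
    case 1
    then show ?thesis
      using w ns by simp
  next
    case 2
    have "(1 - t) *\<^sub>R p = - (t *\<^sub>R q) + r"
      using r by (simp add: algebra_simps)
    then have "p = (1 / (1 - t)) *\<^sub>R (- (t *\<^sub>R q) + r)"
      using 2 by (metis diff_gt_0_iff_gt less_irrefl order_less_trans scaleR_scaleR
          nonzero_eq_divide_eq scaleR_one zero_less_one)
    moreover have "1 - 1 / (1 - t) = (1 / (1 - t)) * (- t)"
      using 2 by (simp add: field_simps)
    ultimately have "p = (1 - 1 / (1 - t)) *\<^sub>R q + (1 / (1 - t)) *\<^sub>R r"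
      by (simp add: scaleR_diff_right)
    moreover have "q \<noteq> r"
    proof
      assume "q = r"
      then have "(1 - t) *\<^sub>R (q - p) = 0"
        using r by (simp add: algebra_simps)
      then show False
        using 2 False by simp
    qed
    ultimately have "smooth_pt p"
      using 2 unit by (intro smooth_between[OF dim2, of p q r "1 / (1 - t)"]) auto
    then show ?thesis
      using ns by simp
  next
    case 3
    have "(1 + t) *\<^sub>R q = t *\<^sub>R p + w"
      using w by (simp add: algebra_simps)
    then have "q = (1 / (1 + t)) *\<^sub>R (t *\<^sub>R p + w)"
      using 3 by (metis add_pos_pos less_irrefl scaleR_scaleR nonzero_eq_divide_eq scaleR_one zero_less_one)
    moreover have "1 - 1 / (1 + t) = (1 / (1 + t)) * t"
      using 3 by (simp add: field_simps)
    ultimately have "q = (1 - 1 / (1 + t)) *\<^sub>R p + (1 / (1 + t)) *\<^sub>R w"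
      by (simp add: scaleR_add_right)
    moreover have "p \<noteq> w"
    proof
      assume "p = w"
      then have "(1 + t) *\<^sub>R (q - p) = 0"
        using w by (simp add: algebra_simps)
      then show False
        using 3 False by simp
    qed
    ultimately have "smooth_pt q"
      using 3 unit by (intro smooth_between[OF dim2, of q p w "1 / (1 + t)"]) auto
    then show ?thesis
      using ns by simp
  qed
qed

text \<open>
  With \<open>m = (a + c) / 2\<close>, the points \<open>b\<close> and \<open>b - 2 m = - d\<close> lie on the line through
  \<open>\<kappa> a\<close> parallel to \<open>m\<close>, which meets the parallelogram \<open>a, - c, - a, c\<close> in a chord of the
  same length with endpoints at the parameters \<open>- (1 + \<kappa>)\<close> and \<open>1 - \<kappa>\<close>. Unless the two
  chords coincide, one of \<open>b\<close>, \<open>- d\<close> lies strictly inside a segment of the unit ball parallel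
  to \<open>m\<close>, so a functional supporting it annihilates \<open>m\<close>.
\<close>

lemma unit_parallelogram_aux:
  fixes a b c d :: "'b::real_normed_vector"
  assumes dim2: "dim (UNIV :: 'b set) = 2"
    and unit: "norm a = 1" "norm b = 1" "norm c = 1" "norm d = 1"
    and sum: "a + c = b + d"
    and b: "b = \<kappa> *\<^sub>R a + \<beta> *\<^sub>R ((1 / 2) *\<^sub>R (a + c))" and \<kappa>: "0 < \<kappa>" "\<kappa> \<le> 1"
  shows "a = b \<or> (\<exists>f. linear f \<and> (\<forall>x. \<bar>f x\<bar> \<le> norm x) \<and> (\<forall>x\<in>{a, b, c, d}. \<bar>f x\<bar> = (1::real)))"
proof -
  have d: "d = a + c - b"
    using sum by (simp add: algebra_simps)
  have rels: "f b = \<kappa> * f a + \<beta> * ((f a + f c) / 2)" "f d = f a + f c - f b"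
    "\<bar>f a\<bar> \<le> 1" "\<bar>f b\<bar> \<le> 1" "\<bar>f c\<bar> \<le> 1" "\<bar>f d\<bar> \<le> 1"
    if f: "linear f" "\<And>x. \<bar>f x\<bar> \<le> norm x" for f :: "'b \<Rightarrow> real"
  proof -
    show "f d = f a + f c - f b"
      unfolding d using f(1) by (simp add: linear_add linear_diff)
    show "f b = \<kappa> * f a + \<beta> * ((f a + f c) / 2)"
      by (subst b) (use f(1) in \<open>simp add: linear_add linear_scale\<close>)
  qed (use f(2)[of a] f(2)[of b] f(2)[of c] f(2)[of d] unit in auto)
  \<comment> \<open>The left side is the convex combination of \<open>p\<close> and \<open>q\<close>
    with weights \<open>(1 + \<kappa>) / 2\<close> and \<open>(1 - \<kappa>) / 2\<close>: the value
    of a functional at an endpoint of the inner chord.\<close>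
  have chord: "\<kappa> * p + (1 - \<kappa>) * ((p + q) / 2) \<le> 1" if "\<bar>p\<bar> \<le> 1" "\<bar>q\<bar> \<le> 1" for p q :: real
  proof -
    have "(1 + \<kappa>) * p \<le> (1 + \<kappa>) * 1" "(1 - \<kappa>) * q \<le> (1 - \<kappa>) * 1"
      using that \<kappa> by (intro mult_left_mono; simp)+
    then have "(1 + \<kappa>) * p + (1 - \<kappa>) * q \<le> 2"
      by simp
    then show ?thesis
      by (simp add: field_simps)
  qed
  have large: "p = 1" if "\<kappa> * p = 1" "\<bar>p\<bar> \<le> 1" for p
  proof -
    have "0 < p"
      using that \<kappa> by (metis zero_less_mult_pos zero_less_one)
    then have "\<kappa> * p \<le> 1 * p"
      using \<kappa> by (intro mult_right_mono) auto
    then show ?thesis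
      using that by simp
  qed
  consider "\<beta> = 1 - \<kappa>" | "\<beta> < 1 - \<kappa>" | "\<beta> > 1 - \<kappa>"
    by linarith
  then show ?thesis
  proof cases
    case 1
    obtain f where f: "linear f" "\<And>x. \<bar>f x\<bar> \<le> norm x" "f b = 1"
      using extremal_support_functional[OF dim2 unit(2)] by metis
    note r = rels[OF f(1,2)]
    show ?thesis
    proof (cases "\<kappa> = 1")
      case True
      then show ?thesis
        using 1 b by simp
    next
      case False
      have "(1 + \<kappa>) * (1 - f a) + (1 - \<kappa>) * (1 - f c) = 0"
        using r(1) f(3) 1 by (simp add: field_simps)
      moreover have "0 \<le> (1 + \<kappa>) * (1 - f a)" "0 \<le> (1 - \<kappa>) * (1 - f c)"
        using r \<kappa> by auto
      ultimately have "(1 + \<kappa>) * (1 - f a) = 0" "(1 - \<kappa>) * (1 - f c) = 0"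
        by linarith+
      then have "f a = 1" "f c = 1"
        using \<kappa> False by auto
      then show ?thesis
        using f r by (intro disjI2 exI[of _ f]) auto
    qed
  next
    \<comment> \<open>From \<open>b\<close>, both the chord endpoint, in direction \<open>m\<close>,
      and \<open>- d\<close>, in direction \<open>- m\<close>, lie in the unit ball. As
      \<open>f b = 1\<close> is maximal there, \<open>f\<close> annihilates \<open>m\<close>; the
      remaining case argues likewise from \<open>- d\<close>.\<close>
    case 2
    obtain f where f: "linear f" "\<And>x. \<bar>f x\<bar> \<le> norm x" "f b = 1"
      using extremal_support_functional[OF dim2 unit(2)] by metis
    note r = rels[OF f(1,2)]
    define M where "M = (f a + f c) / 2"
    have fb: "\<kappa> * f a + \<beta> * M = 1"
      using r(1) f(3) by (simp only: M_def)
    moreover have "\<kappa> * f a + (1 - \<kappa>) * M \<le> 1"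
      using chord[OF r(3) r(5)] by (simp only: M_def)
    ultimately have "(1 - \<kappa> - \<beta>) * M \<le> 0"
      by (simp add: left_diff_distrib)
    then have "M \<le> 0"
      using 2 by (simp add: mult_le_0_iff)
    moreover have "M \<ge> 0"
      using r(2,6) f(3) by (simp add: M_def)
    ultimately have "M = 0"
      by simp
    then have "f a = 1"
      using fb by (intro large[OF _ r(3)]) simp
    then show ?thesis
      using f r \<open>M = 0\<close> by (intro disjI2 exI[of _ f]) (auto simp: M_def)
  next
    case 3
    obtain f where f: "linear f" "\<And>x. \<bar>f x\<bar> \<le> norm x" "f (- d) = 1"
      using extremal_support_functional[OF dim2, of "- d"] unit by (metis norm_minus_cancel)
    note r = rels[OF f(1,2)]
    have fd: "f d = - 1"
      using f by (simp add: linear_neg)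
    define M where "M = (f a + f c) / 2"
    have "\<kappa> * - f c + (1 - \<kappa>) * ((- f c + - f a) / 2) \<le> 1"
      using chord[of "- f c" "- f a"] r by simp
    then have "\<kappa> * (f a - 2 * M) - (1 - \<kappa>) * M \<le> 1"
      by (simp add: M_def field_simps)
    moreover have fb: "\<kappa> * f a + \<beta> * M = 2 * M + 1"
    proof -
      have "f b = \<kappa> * f a + \<beta> * M"
        using r(1) by (simp only: M_def)
      moreover have "f b = 2 * M + 1"
        using r(2) fd by (simp only: M_def) argo
      ultimately show ?thesis
        by simp
    qed
    ultimately have "0 \<le> (\<beta> + \<kappa> - 1) * M"
      by (simp add: algebra_simps)
    then have "M \<ge> 0"
      using 3 by (simp add: zero_le_mult_iff)
    moreover have "M \<le> 0"
      using r(2,4) fd by (simp add: M_def)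
    ultimately have "M = 0"
      by simp
    then have "f a = 1"
      using fb by (intro large[OF _ r(3)]) simp
    then show ?thesis
      using f r \<open>M = 0\<close> fd by (intro disjI2 exI[of _ f]) (auto simp: M_def)
  qed
qed

text \<open>In the basis \<open>m\<close>, \<open>a\<close> the coefficients of \<open>a\<close> in
  \<open>b\<close> and \<open>d\<close> are opposite, since \<open>b + d = 2 m\<close>. Exchanging
  \<open>b\<close> and \<open>d\<close> makes the coefficient positive, and exchanging the two
  diagonals inverts it, so it may be assumed to lie in \<open>(0, 1]\<close>.\<close>

lemma unit_parallelogram:
  fixes a b c d :: "'b::real_normed_vector"
  assumes dim2: "dim (UNIV :: 'b set) = 2"
    and unit: "norm a = 1" "norm b = 1" "norm c = 1" "norm d = 1"
    and sum: "a + c = b + d"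
  shows "(a = b \<and> c = d) \<or> (a = d \<and> c = b) \<or> (a = - c \<and> b = - d) \<or>
    (\<exists>f. linear f \<and> (\<forall>x. \<bar>f x\<bar> \<le> norm x) \<and> (\<forall>x\<in>{a, b, c, d}. \<bar>f x\<bar> = (1::real)))"
    (is "_ \<or> _ \<or> _ \<or> ?common {a, b, c, d}")
proof (cases "a + c = 0")
  case True
  then show ?thesis
    using sum by (metis eq_neg_iff_add_eq_0)
next
  case False
  define m where "m = (1 / 2) *\<^sub>R (a + c)"
  have "m \<noteq> 0"
    using False by (simp add: m_def)
  have m2: "m = (1 / 2) *\<^sub>R (b + d)"
    using sum by (simp add: m_def)
  \<comment> \<open>If \<open>a\<close> is a multiple of the midpoint \<open>m\<close>, so is
    \<open>c\<close>; equal norms and the average \<open>m\<close> force \<open>a = c\<close>. A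
    functional supporting \<open>a\<close> then has to be 1 at \<open>b\<close> and \<open>d\<close>
    as well.\<close>
  have parallel: "?common {a, b, c, d}"
    if a: "a \<in> span {m}" and m: "m = (1 / 2) *\<^sub>R (a + c)" and sum: "a + c = b + d"
      and unit: "norm a = 1" "norm b = 1" "norm c = 1" "norm d = 1"
    for a b c d
  proof -
    obtain s where s: "a = s *\<^sub>R m"
      using a by (auto simp: span_singleton)
    have "a + c = 2 *\<^sub>R m"
      using m by simp
    then have c: "c = (2 - s) *\<^sub>R m"
      using s by (simp add: algebra_simps)
    have "\<bar>s\<bar> * norm m = 1" "\<bar>2 - s\<bar> * norm m = 1"
      using s c unit by auto
    then have "\<bar>s\<bar> = \<bar>2 - s\<bar>"
      by (metis mult_cancel_right zero_neq_one mult_zero_right)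
    then have "s = 1"
      by linarith
    then have "a = c"
      using s c by simp
    obtain f where f: "linear f" "\<And>x. \<bar>f x\<bar> \<le> norm x" "f a = 1"
      using extremal_support_functional[OF dim2 unit(1)] by metis
    have "f b + f d = 2"
      using f sum \<open>a = c\<close> by (metis linear_add one_add_one)
    then have "f b = 1" "f d = 1"
      using f(2)[of b] f(2)[of d] unit by linarith+
    then show ?thesis
      using f \<open>a = c\<close> by (intro exI[of _ f]) auto
  qed
  show ?thesis
  proof (cases "a \<in> span {m} \<or> b \<in> span {m}")
    case True
    then have "?common {a, b, c, d}"
    proof
      assume "a \<in> span {m}"
      then show ?thesis
        using m_def sum unit by (rule parallel)
    next
      assume "b \<in> span {m}"
      then have "?common {b, a, d, c}"
        using m2 sum[symmetric] unit(2,1,4,3) by (rule parallel)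
      then show ?thesis
        by (simp add: insert_commute)
    qed
    then show ?thesis
      by blast
  next
    case F: False
    obtain \<beta> \<kappa> where b: "b = \<beta> *\<^sub>R m + \<kappa> *\<^sub>R a"
      using plane_decomp[OF dim2 \<open>m \<noteq> 0\<close>, of a b] F by blast
    have "b + d = 2 *\<^sub>R m"
      using m2 by simp
    then have d: "d = (2 - \<beta>) *\<^sub>R m + (- \<kappa>) *\<^sub>R a"
      using b by (simp add: algebra_simps)
    have "\<kappa> \<noteq> 0"
      using F b by (auto simp: span_base span_scale)
    have pos: "a = b \<or> ?common {a, b, c, d}"
      if b: "b = \<beta> *\<^sub>R m + \<kappa> *\<^sub>R a" and "\<kappa> > 0" and sum: "a + c = b + d"
        and unit: "norm b = 1" "norm d = 1"
      for b d \<beta> \<kappa>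
    proof (cases "\<kappa> \<le> 1")
      case True
      have "b = \<kappa> *\<^sub>R a + \<beta> *\<^sub>R ((1 / 2) *\<^sub>R (a + c))"
        using b by (simp only: m_def add.commute)
      from unit_parallelogram_aux[OF dim2 assms(2) unit(1) assms(4) unit(2) sum this \<open>\<kappa> > 0\<close> True]
      show ?thesis .
    next
      case False
      have "\<kappa> *\<^sub>R a = b - \<beta> *\<^sub>R m"
        using b by simp
      then have "a = (1 / \<kappa>) *\<^sub>R (b - \<beta> *\<^sub>R m)"
        using \<open>\<kappa> > 0\<close> by (metis less_irrefl scaleR_scaleR nonzero_eq_divide_eq scaleR_one)
      then have "a = (1 / \<kappa>) *\<^sub>R b + (- \<beta> / \<kappa>) *\<^sub>R ((1 / 2) *\<^sub>R (b + d))"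
        using sum by (simp add: m_def algebra_simps)
      from unit_parallelogram_aux[OF dim2 unit(1) assms(2) unit(2) assms(4) sum[symmetric] this]
      have "b = a \<or> ?common {b, a, d, c}"
        using False by simp
      then show ?thesis
        by (auto simp: insert_commute)
    qed
    show ?thesis
    proof (cases "\<kappa> > 0")
      case True
      then show ?thesis
        using pos[OF b True sum] unit sum by auto
    next
      case False
      then have "a = d \<or> ?common {a, d, c, b}"
        using d sum unit \<open>\<kappa> \<noteq> 0\<close> by (intro pos[of d "2 - \<beta>" "- \<kappa>"]) (auto simp: add.commute)
      then show ?thesis
        using sum by (auto simp: insert_commute)
    qed
  qed
qed

text \<open>When vertices coincide up to sign, \<open>d\<close> inherits nonsmoothness directly.
  Otherwise a functional of modulus 1 at all four vertices puts them on one line after sign changes,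
  where the collinear case applies.\<close>

lemma nonsmooth_parallelogram:
  fixes a b c d :: "'b::real_normed_vector"
  assumes dim2: "dim (UNIV :: 'b set) = 2"
    and unit: "norm a = 1" "norm b = 1" "norm c = 1" "norm d = 1"
    and sum: "a + c = b + d"
    and ns: "\<not> smooth_pt a" "\<not> smooth_pt b" "\<not> smooth_pt c"
  shows "\<not> smooth_pt d"
proof -
  consider "a = b \<and> c = d" | "a = d \<and> c = b" | "a = - c \<and> b = - d"
    | f where "linear f" "\<And>x. x \<in> {a, b, c, d} \<Longrightarrow> \<bar>f x\<bar> = (1::real)"
    using unit_parallelogram[OF assms(1-6)] by blast
  then show ?thesis
  proof cases
    case 4
    note f = \<open>linear f\<close>
    have "f a + f c = f b + f d"
      using f sum by (metis linear_add)
    moreover have "f a = 1 \<or> f a = - 1" "f b = 1 \<or> f b = - 1" "f c = 1 \<or> f c = - 1" "f d = 1 \<or> f d = - 1"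
      using 4(2)[of a] 4(2)[of b] 4(2)[of c] 4(2)[of d] by (simp_all add: abs_eq_iff')
    \<comment> \<open>Either all four signs agree, or each diagonal carries opposite signs. In the
      second case \<open>b\<close> and one of \<open>a\<close>, \<open>c\<close> are replaced by
      their negatives.\<close>
    ultimately have "(f a = f b \<and> f c = f b \<and> f b \<noteq> 0)
      \<or> (- f c = f a \<and> - f b = f a \<and> f a \<noteq> 0) \<or> (- f a = f c \<and> - f b = f c \<and> f c \<noteq> 0)"
      by (elim disjE) simp_all
    then consider "f a = f b" "f c = f b" "f b \<noteq> 0"
      | "f (- c) = f a" "f (- b) = f a" "f a \<noteq> 0"
      | "f (- a) = f c" "f (- b) = f c" "f c \<noteq> 0"
      unfolding linear_neg[OF f] by blast
    then show ?thesis
    proof cases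
      case 1
      then show ?thesis
        using collinear_nonsmooth[OF dim2, of b a c d f "f b"] f sum unit ns by simp
    next
      case 2
      have "- c + d = a + - b"
        using sum by (simp add: algebra_simps)
      then show ?thesis
        using 2 collinear_nonsmooth[OF dim2, of "- c" a "- b" d f "f a"] f unit ns by simp
    next
      case 3
      have "- a + d = c + - b"
        using sum by (simp add: algebra_simps)
      then show ?thesis
        using 3 collinear_nonsmooth[OF dim2, of "- a" c "- b" d f "f c"] f unit ns by simp
    qed
  qed (use ns in \<open>auto simp: smooth_pt_minus\<close>)
qed

section \<open>Common elements of the spans of supporting functionals\<close>

lemma JY_nonzero: "f \<in> JY y \<Longrightarrow> f \<noteq> 0"
  by (auto simp: JY_def)

text \<open>At a nonsmooth point the span is the whole dual and meets any other span nontrivially;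
  at two smooth points the spans are lines, which are equal or independent.\<close>

lemma span_JY_pair:
  fixes a c :: "'b::real_normed_vector"
  assumes dim2: "dim (UNIV :: 'b set) = 2" and unit: "norm a = 1" "norm c = 1"
  shows "(\<exists>f. f \<noteq> 0 \<and> f \<in> span (JY a) \<and> f \<in> span (JY c)) \<or>
    (\<exists>f g. linear f \<and> linear g \<and> f \<notin> span {g} \<and> g \<notin> span {f} \<and>
       span (JY a) = span {f} \<and> span (JY c) = span {g})"
proof -
  obtain f where f: "f \<in> JY a"
    using JY_nonempty[OF dim2 unit(1)] .
  obtain g where g: "g \<in> JY c"
    using JY_nonempty[OF dim2 unit(2)] .
  have lin: "linear f" "linear g"
    using f g by (auto simp: JY_def)
  consider "\<not> smooth_pt a" | "\<not> smooth_pt c" | "smooth_pt a" "smooth_pt c"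
    by blast
  then show ?thesis
  proof cases
    case 1
    then show ?thesis
      using nonsmooth_span_JY[OF dim2 unit(1)] g lin JY_nonzero span_base by blast
  next
    case 2
    then show ?thesis
      using nonsmooth_span_JY[OF dim2 unit(2)] f lin JY_nonzero span_base by blast
  next
    case 3
    then have "JY a = {f}" "JY c = {g}"
      using f g by (auto simp: smooth_pt_def)
    then show ?thesis
      using f g lin JY_nonzero[OF f] JY_nonzero[OF g]
      by (cases "f \<in> span {g} \<or> g \<in> span {f}") (auto intro: span_base)
  qed
qed

lemma norming_in_span_JY:
  fixes x :: "'b::real_normed_vector"
  assumes dim2: "dim (UNIV :: 'b set) = 2" and x: "norm x = 1"
    and f: "linear f" "\<And>x. \<bar>f x\<bar> \<le> norm x" "\<bar>f x\<bar> = 1"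
  shows "f \<in> span (JY x)"
proof (cases "f x = 1")
  case True
  then show ?thesis
    using f x by (intro span_base) (auto simp: JY_iff[OF dim2])
next
  case False
  then have "f (- x) = 1"
    using f by (simp add: linear_neg)
  then have "f \<in> span (JY (- x))"
    using f x by (intro span_base) (auto simp: JY_iff[OF dim2])
  then show ?thesis
    by simp
qed

text \<open>If the vertices coincide in pairs up to sign, only two spans occur, each at two indices,
  and comparing them decides. Otherwise a functional of modulus 1 at all vertices lies in all four
  spans.\<close>

lemma span_JY_parallelogram:
  fixes y :: "nat \<Rightarrow> 'b::real_normed_vector"
  assumes dim2: "dim (UNIV :: 'b set) = 2"
    and unit: "\<And>i. i \<in> {1..4} \<Longrightarrow> norm (y i) = 1" and sum: "y 1 + y 3 = y 2 + y 4"
  obtains (common) f where "f \<noteq> 0" "\<And>i. i \<in> {1..4} \<Longrightarrow> f \<in> span (JY (y i))"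
  | (pairs) f g I where "linear f" "linear g" "f \<notin> span {g}" "g \<notin> span {f}"
      "I \<subseteq> {1..4}" "card I = 2"
      "\<And>i. i \<in> I \<Longrightarrow> span (JY (y i)) = span {f}"
      "\<And>i. i \<in> {1..4} - I \<Longrightarrow> span (JY (y i)) = span {g}"
proof -
  have pair: thesis
    if "{1..4} = {i, j, k, l}" "distinct [i, j, k, l]"
      and ij: "span (JY (y j)) = span (JY (y i))" and kl: "span (JY (y l)) = span (JY (y k))"
    for i j k l
  proof -
    have "i \<in> {1..4}" "k \<in> {1..4}"
      using that(1) by auto
    from span_JY_pair[OF dim2 unit[OF this(1)] unit[OF this(2)]] show thesis
    proof (elim disjE exE conjE)
      fix f assume "f \<noteq> 0" "f \<in> span (JY (y i))" "f \<in> span (JY (y k))"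
      then show thesis
        using that by (intro common[of f]) auto
    next
      fix f g assume "linear f" "linear g" "f \<notin> span {g}" "g \<notin> span {f}"
        "span (JY (y i)) = span {f}" "span (JY (y k)) = span {g}"
      then show thesis
        using that by (intro pairs[of f g "{i, j}"]) auto
    qed
  qed
  have ind: "{1..4} = {1, 2, 3, 4::nat}"
    by auto
  have un: "norm (y 1) = 1" "norm (y 2) = 1" "norm (y 3) = 1" "norm (y 4) = 1"
    using unit by auto
  consider "y 1 = y 2 \<and> y 3 = y 4" | "y 1 = y 4 \<and> y 3 = y 2" | "y 1 = - y 3 \<and> y 2 = - y 4"
    | f where "linear f" "\<And>x. \<bar>f x\<bar> \<le> norm x" "\<And>x. x \<in> {y 1, y 2, y 3, y 4} \<Longrightarrow> \<bar>f x\<bar> = (1::real)"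
    using unit_parallelogram[OF dim2 un sum] by blast
  then show thesis
  proof cases
    case 1
    then show thesis
      by (intro pair[of 1 2 3 4]) auto
  next
    case 2
    then show thesis
      by (intro pair[of 1 4 2 3]) auto
  next
    case 3
    then show thesis
      by (intro pair[of 1 3 2 4]) auto
  next
    case 4
    have "f \<in> span (JY (y i))" if "i \<in> {1..4}" for i
    proof (rule norming_in_span_JY[OF dim2 unit[OF that] 4(1,2)])
      have "i \<in> {1, 2, 3, 4}"
        using that unfolding ind .
      then show "\<bar>f (y i)\<bar> = 1"
        by (intro 4(3)) auto
    qed
    moreover have "f \<noteq> 0"
      using 4(3)[of "y 1"] by auto
    ultimately show thesis
      using common by blast
  qed
qed

section \<open>Dual bases of the plane\<close>

lemma dual_pair:
  fixes f g :: "'b::real_vector \<Rightarrow> real"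
  assumes lin: "linear f" "linear g" and ind: "f \<notin> span {g}" "g \<notin> span {f}"
  obtains u v where "f u = 1" "f v = 0" "g u = 0" "g v = 1"
proof -
  have ex: "\<exists>v. f v = 0 \<and> g v = 1"
    if lin: "linear f" "linear g" and ind: "f \<notin> span {g}" "g \<notin> span {f}" for f g :: "'b \<Rightarrow> real"
  proof -
    have "f \<noteq> 0"
      using ind(1) span_zero by blast
    then obtain y where y: "f y \<noteq> 0"
      by (auto simp: fun_eq_iff)
    have "\<exists>x. g x \<noteq> c * f x" for c
    proof (rule ccontr)
      assume "\<nexists>x. g x \<noteq> c * f x"
      then have "g = c *\<^sub>R f"
        by (intro ext) (simp add: scaleR_fun_def)
      then show False
        using ind(2) by (simp add: span_base span_scale)
    qed
    then obtain x where x: "g x \<noteq> (g y / f y) * f x" ..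
    \<comment> \<open>Subtracting a multiple of \<open>y\<close> moves \<open>x\<close> into the
      kernel of \<open>f\<close>; the choice of \<open>x\<close> keeps \<open>g\<close> nonzero
      there.\<close>
    define w where "w = x - (f x / f y) *\<^sub>R y"
    have "f w = 0" "g w \<noteq> 0"
      using lin x y by (auto simp: w_def linear_diff linear_scale)
    then show ?thesis
      using lin by (intro exI[of _ "(1 / g w) *\<^sub>R w"]) (simp add: linear_scale)
  qed
  show ?thesis
    using ex[OF lin ind] ex[OF lin(2,1) ind(2,1)] that by blast
qed

lemma extend_to_dual_pair:
  fixes f :: "'b::real_vector \<Rightarrow> real"
  assumes dim2: "dim (UNIV :: 'b set) = 2" and f: "linear f" "f \<noteq> 0"
  obtains g :: "'b \<Rightarrow> real" and u v where "linear g" "f u = 1" "f v = 0" "g u = 0" "g v = 1"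
proof -
  obtain y where y: "f y \<noteq> 0"
    using f by (auto simp: fun_eq_iff)
  define u where "u = (1 / f y) *\<^sub>R y"
  have u: "f u = 1"
    using f y by (simp add: u_def linear_scale)
  obtain z where z: "z \<notin> span {u}"
    using plane_second_vector[OF dim2] .
  define v where "v = z - f z *\<^sub>R u"
  have v: "f v = 0"
    using f u by (simp add: v_def linear_diff linear_scale)
  have "v \<noteq> 0"
    using z unfolding v_def by (metis eq_iff_diff_eq_0 singletonI span_base span_scale)
  have "u \<notin> span {v}"
    using f u v by (auto simp: span_singleton linear_scale)
  then have ind: "independent {u, v}" "u \<noteq> v"
    using \<open>v \<noteq> 0\<close> by (auto simp: independent_insert span_base)
  obtain g where "linear g" "g u = 0" "g v = (1::real)"
    using linear_independent_extend[OF ind(1), of "\<lambda>x. if x = u then 0 else 1"] ind(2) by auto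
  then show ?thesis
    using u v by (intro that[of g u v])
qed

lemma dual_pair_expansion:
  fixes f g :: "'b::real_vector \<Rightarrow> real"
  assumes dim2: "dim (UNIV :: 'b set) = 2" and lin: "linear f" "linear g"
    and dual: "f u = 1" "f v = 0" "g u = 0" "g v = 1"
  shows "x = f x *\<^sub>R u + g x *\<^sub>R v"
proof -
  have "u \<noteq> 0"
    using dual lin by (auto simp: linear_0)
  moreover have "v \<notin> span {u}"
    using dual linear_scale[OF lin(2)] by (auto simp: span_singleton)
  ultimately obtain s t where x: "x = s *\<^sub>R u + t *\<^sub>R v"
    using plane_decomp[OF dim2] by blast
  have "f x = s" "g x = t"
    using dual lin by (simp_all add: x linear_add linear_scale)
  then show ?thesis
    using x by simp
qed

section \<open>Operators on the cube\<close>

lemma exhaust_4_interval: "{1..4} = {1, 2, 3, 4::nat}"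
  by auto

lemma xpt_relation: "xpt 1 + xpt 3 = xpt 2 + xpt 4"
  by (simp add: xpt_def vec_eq_iff forall_3)

lemma supnorm_le_iff: "supnorm x \<le> r \<longleftrightarrow> (\<forall>i. \<bar>x $ i\<bar> \<le> r)"
  by (auto simp: supnorm_def)

lemma supnorm_scaleR: "supnorm (c *\<^sub>R x) = \<bar>c\<bar> * supnorm x"
proof (rule antisym)
  have le: "supnorm (c *\<^sub>R x) \<le> \<bar>c\<bar> * supnorm x" for c x
    using supnorm_le_iff[of x "supnorm x"] by (simp add: supnorm_le_iff abs_mult mult_left_mono)
  show "supnorm (c *\<^sub>R x) \<le> \<bar>c\<bar> * supnorm x"
    by (rule le)
  show "\<bar>c\<bar> * supnorm x \<le> supnorm (c *\<^sub>R x)"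
  proof (cases "c = 0")
    case False
    have "supnorm x \<le> \<bar>1 / c\<bar> * supnorm (c *\<^sub>R x)"
      using le[of "1 / c" "c *\<^sub>R x"] False by simp
    then show ?thesis
      using False by (simp add: field_simps)
  qed (auto simp: supnorm_def)
qed

lemma supnorm_xpt: "i \<in> {1..4} \<Longrightarrow> supnorm (xpt i) \<le> 1"
  unfolding exhaust_4_interval by (auto simp: xpt_def supnorm_le_iff forall_3)

text \<open>
  The coefficients are the differences of the weights of antipodal vertices in the trilinear
  interpolation of a point of the cube between its vertices.
\<close>

lemma cube_expansion:
  fixes x :: "real^3"
  assumes "\<And>i. \<bar>x $ i\<bar> \<le> 1"
  obtains c1 c2 c3 c4 where "x = c1 *\<^sub>R xpt 1 + c2 *\<^sub>R xpt 2 + c3 *\<^sub>R xpt 3 + c4 *\<^sub>R xpt 4"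
    "\<bar>c1\<bar> + \<bar>c2\<bar> + \<bar>c3\<bar> + \<bar>c4\<bar> \<le> 1"
proof -
  define w where "w r s t = (1 + r * x $ 1) * (1 + s * x $ 2) * (1 + t * x $ 3) / 8" for r s t :: real
  have nonneg: "w r s t \<ge> 0" if "r \<in> {1, -1}" "s \<in> {1, -1}" "t \<in> {1, -1}" for r s t
  proof -
    have "1 + r * x $ i \<ge> 0" if "r \<in> {1, -1}" for r i
      using that assms[of i] by auto
    then show ?thesis
      using that by (simp add: w_def)
  qed
  have abs: "\<bar>w r s t - w (- r) (- s) (- t)\<bar> \<le> w r s t + w (- r) (- s) (- t)"
    if "r \<in> {1, -1}" "s \<in> {1, -1}" "t \<in> {1, -1}" for r s t
    using nonneg[of r s t] nonneg[of "- r" "- s" "- t"] that by auto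
  show ?thesis
  proof (rule that)
    show "x = (w 1 1 1 - w (- 1) (- 1) (- 1)) *\<^sub>R xpt 1 + (w (- 1) 1 1 - w 1 (- 1) (- 1)) *\<^sub>R xpt 2
      + (w (- 1) (- 1) 1 - w 1 1 (- 1)) *\<^sub>R xpt 3 + (w 1 (- 1) 1 - w (- 1) 1 (- 1)) *\<^sub>R xpt 4"
      by (simp add: xpt_def vec_eq_iff forall_3 w_def field_simps)
    have "w 1 1 1 + w (- 1) (- 1) (- 1) + (w (- 1) 1 1 + w 1 (- 1) (- 1))
      + (w (- 1) (- 1) 1 + w 1 1 (- 1)) + (w 1 (- 1) 1 + w (- 1) 1 (- 1)) = 1"
      by (simp add: w_def field_simps)
    then show "\<bar>w 1 1 1 - w (- 1) (- 1) (- 1)\<bar> + \<bar>w (- 1) 1 1 - w 1 (- 1) (- 1)\<bar>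
      + \<bar>w (- 1) (- 1) 1 - w 1 1 (- 1)\<bar> + \<bar>w 1 (- 1) 1 - w (- 1) 1 (- 1)\<bar> \<le> 1"
      using abs[of 1 1 1] abs[of "- 1" 1 1] abs[of "- 1" "- 1" 1] abs[of 1 "- 1" 1] by simp
  qed
qed

text \<open>Every point of the cube is an absolutely convex combination of four vertices, one from
  each antipodal pair, so these four decide the operator norm.\<close>

lemma norm_le_of_vertices:
  fixes A :: "real^3 \<Rightarrow> 'b::real_normed_vector"
  assumes A: "linear A" and r: "\<And>i. i \<in> {1..4} \<Longrightarrow> norm (A (xpt i)) \<le> r" and x: "supnorm x \<le> 1"
  shows "norm (A x) \<le> r"
proof -
  obtain c1 c2 c3 c4 where x: "x = c1 *\<^sub>R xpt 1 + c2 *\<^sub>R xpt 2 + c3 *\<^sub>R xpt 3 + c4 *\<^sub>R xpt 4"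
    and c: "\<bar>c1\<bar> + \<bar>c2\<bar> + \<bar>c3\<bar> + \<bar>c4\<bar> \<le> 1"
    using cube_expansion[of x] x unfolding supnorm_le_iff by blast
  have le: "norm (A (xpt 1)) \<le> r" "norm (A (xpt 2)) \<le> r" "norm (A (xpt 3)) \<le> r" "norm (A (xpt 4)) \<le> r"
    by (auto intro!: r)
  then have "0 \<le> r"
    using norm_ge_zero order_trans by blast
  have "A x = c1 *\<^sub>R A (xpt 1) + c2 *\<^sub>R A (xpt 2) + c3 *\<^sub>R A (xpt 3) + c4 *\<^sub>R A (xpt 4)"
    unfolding x using A by (simp only: linear_add linear_scale)
  then have "norm (A x) \<le> \<bar>c1\<bar> * norm (A (xpt 1)) + \<bar>c2\<bar> * norm (A (xpt 2))
      + \<bar>c3\<bar> * norm (A (xpt 3)) + \<bar>c4\<bar> * norm (A (xpt 4))"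
    by (metis (no_types, opaque_lifting) norm_scaleR norm_triangle_mono order_refl)
  also have "\<dots> \<le> \<bar>c1\<bar> * r + \<bar>c2\<bar> * r + \<bar>c3\<bar> * r + \<bar>c4\<bar> * r"
    using le by (intro add_mono mult_left_mono) auto
  also have "\<dots> = (\<bar>c1\<bar> + \<bar>c2\<bar> + \<bar>c3\<bar> + \<bar>c4\<bar>) * r"
    by (simp add: algebra_simps)
  also have "\<dots> \<le> 1 * r"
    using c \<open>0 \<le> r\<close> by (rule mult_right_mono)
  finally show ?thesis
    by simp
qed

lemma opnormX_le:
  fixes A :: "real^3 \<Rightarrow> 'b::real_normed_vector"
  assumes "linear A" "\<And>i. i \<in> {1..4} \<Longrightarrow> norm (A (xpt i)) \<le> r"
  shows "opnormX A \<le> r"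
  unfolding opnormX_def
proof (rule cSup_least)
  show "{norm (A x) |x. supnorm x \<le> 1} \<noteq> {}"
    using supnorm_xpt[of 1] by auto
qed (use norm_le_of_vertices[OF assms] in auto)

text \<open>The supremum in \<open>opnormX\<close> dominates its elements only if the set is
  bounded; the largest vertex value is a bound.\<close>

lemma norm_le_opnormX:
  fixes A :: "real^3 \<Rightarrow> 'b::real_normed_vector"
  assumes "linear A" "supnorm x \<le> 1"
  shows "norm (A x) \<le> opnormX A"
  unfolding opnormX_def
proof (rule cSup_upper)
  have "norm (A x) \<le> Max ((\<lambda>i. norm (A (xpt i))) ` {1..4})" if "supnorm x \<le> 1" for x
    by (rule norm_le_of_vertices[OF assms(1) _ that]) (intro Max_ge; simp)
  then show "bdd_above {norm (A x) |x. supnorm x \<le> 1}"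
    by (intro bdd_aboveI) auto
qed (use assms in auto)

section \<open>Linear functionals on the operator space\<close>

lemma op_functional_sum:
  assumes "op_functional \<Phi>" "finite K" "\<And>k. k \<in> K \<Longrightarrow> linear (F k)"
  shows "\<Phi> (\<lambda>x. \<Sum>k\<in>K. F k x) = (\<Sum>k\<in>K. \<Phi> (F k))"
  using assms(2,3)
proof (induction K rule: finite_induct)
  case empty
  have "linear (\<lambda>x. 0)"
    by (simp add: linear_iff)
  then have "\<Phi> (0 *\<^sub>R (\<lambda>x. 0)) = 0 * \<Phi> (\<lambda>x. 0)"
    using assms(1) unfolding op_functional_def by blast
  then show ?case
    by (simp add: scaleR_fun_def)
next
  case (insert k K)
  have "linear (F k)" "linear (\<lambda>x. \<Sum>k\<in>K. F k x)"
    using insert.prems by (auto intro: linear_compose_sum)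
  then have "\<Phi> (F k + (\<lambda>x. \<Sum>k\<in>K. F k x)) = \<Phi> (F k) + \<Phi> (\<lambda>x. \<Sum>k\<in>K. F k x)"
    using assms(1) unfolding op_functional_def by blast
  then show ?case
    using insert by (simp add: plus_fun_def)
qed

text \<open>The elementary tensor of \<open>h\<close> and \<open>x\<close> in the dual of the
  operator space; the value 0 off the linear maps follows the convention of
  \<open>op_functional\<close>.\<close>

definition tensor_functional ::
    "('b::real_normed_vector \<Rightarrow> real) \<Rightarrow> real^3 \<Rightarrow> (real^3 \<Rightarrow> 'b) \<Rightarrow> real" where
  "tensor_functional h x A = (if linear A then h (A x) else 0)"

lemma linear_tensor_functional: "linear (\<lambda>h. tensor_functional h x)"
  by (auto simp: linear_iff tensor_functional_def fun_eq_iff scaleR_fun_def)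

lemma linear_tensor_functional_right: "linear h \<Longrightarrow> linear (tensor_functional h)"
  by (auto simp: linear_iff tensor_functional_def fun_eq_iff scaleR_fun_def)

text \<open>The operators carrying one coordinate to multiples of \<open>u\<close> or
  \<open>v\<close> span all operators; the values of \<open>\<Phi>\<close> on them are the
  coordinates of \<open>x\<close> and \<open>x'\<close>.\<close>

lemma op_functional_expansion:
  fixes f g :: "'b::real_normed_vector \<Rightarrow> real"
  assumes lin: "linear f" "linear g" and exp: "\<And>y. y = f y *\<^sub>R u + g y *\<^sub>R v"
    and \<Phi>: "op_functional \<Phi>"
  obtains x x' where "\<Phi> = tensor_functional f x + tensor_functional g x'"
proof -
  define E where "E w k = (\<lambda>x::real^3. x $ k *\<^sub>R w)" for w :: 'b and k
  have linE: "linear (E w k)" for w k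
    by (auto simp: linear_iff E_def algebra_simps)
  have linscale: "linear (c *\<^sub>R E w k)" for c w k
    by (auto simp: linear_iff E_def algebra_simps scaleR_fun_def)
  have scale: "\<Phi> (c *\<^sub>R E w k) = c * \<Phi> (E w k)" for c w k
    using \<Phi> linE unfolding op_functional_def by blast
  define x where "x = (\<chi> k. \<Phi> (E u k))"
  define x' where "x' = (\<chi> k. \<Phi> (E v k))"
  have "\<Phi> A = (tensor_functional f x + tensor_functional g x') A" for A
  proof (cases "linear A")
    case True
    define a where "a k = A (axis k 1)" for k
    have A: "A z = (\<Sum>k\<in>UNIV. z $ k *\<^sub>R a k)" for z
    proof -
      have "A (\<Sum>k\<in>UNIV. z $ k *\<^sub>R axis k 1) = (\<Sum>k\<in>UNIV. z $ k *\<^sub>R a k)"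
        using True by (simp add: linear_sum linear_scale a_def)
      then show ?thesis
        using basis_expansion[of z] by (simp add: scalar_mult_eq_scaleR)
    qed
    define F where "F k = f (a k) *\<^sub>R E u k + g (a k) *\<^sub>R E v k" for k
    have "A = (\<lambda>z. \<Sum>k\<in>UNIV. F k z)"
    proof
      fix z
      have "z $ k *\<^sub>R a k = F k z" for k
        by (subst exp[of "a k"]) (simp add: F_def E_def scaleR_fun_def scaleR_add_right mult.commute)
      then show "A z = (\<Sum>k\<in>UNIV. F k z)"
        using A by simp
    qed
    then have "\<Phi> A = (\<Sum>k\<in>UNIV. \<Phi> (F k))"
      using op_functional_sum[OF \<Phi>, of UNIV F] linscale
      by (auto simp: F_def plus_fun_def intro!: linear_compose_add)
    also have "\<dots> = (\<Sum>k\<in>UNIV. f (a k) * x $ k + g (a k) * x' $ k)"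
    proof (rule sum.cong)
      fix k
      have "\<Phi> (F k) = \<Phi> (f (a k) *\<^sub>R E u k) + \<Phi> (g (a k) *\<^sub>R E v k)"
        using \<Phi> linscale unfolding op_functional_def F_def by blast
      then show "\<Phi> (F k) = f (a k) * x $ k + g (a k) * x' $ k"
        by (simp add: scale x_def x'_def)
    qed simp
    also have "\<dots> = f (A x) + g (A x')"
      using lin by (simp add: A linear_sum linear_scale sum.distrib mult.commute)
    finally show ?thesis
      using True by (simp add: tensor_functional_def)
  next
    case False
    then show ?thesis
      using \<Phi> by (simp add: op_functional_def tensor_functional_def)
  qed
  then show ?thesis
    using that by blast
qed

section \<open>Functionals supporting an operator\<close>

text \<open>A crude bound uniform in \<open>A\<close> suffices to make dual norms finite; the added
  1 keeps the divisor positive even at the origin.\<close>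

lemma norm_le_supnorm_mult:
  fixes A :: "real^3 \<Rightarrow> 'b::real_normed_vector"
  assumes A: "linear A" "opnormX A \<le> 1"
  shows "norm (A x) \<le> supnorm x + 1"
proof -
  define s where "s = supnorm x + 1"
  have "0 \<le> supnorm x"
    using supnorm_le_iff[of x "supnorm x"] by (metis abs_ge_zero order_refl order_trans)
  then have s: "0 < s" "supnorm x \<le> s"
    by (simp_all add: s_def)
  have "supnorm ((1 / s) *\<^sub>R x) \<le> 1"
    using s by (simp add: supnorm_scaleR)
  then have "norm (A ((1 / s) *\<^sub>R x)) \<le> 1"
    using norm_le_opnormX[OF A(1)] A(2) order_trans by blast
  then have "norm (A x) \<le> s"
    using A(1) s by (simp add: linear_scale field_simps)
  then show ?thesis
    by (simp add: s_def)
qed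

lemma scaleR_fun_app: "(c *\<^sub>R A) x = c *\<^sub>R A x"
  by (simp add: scaleR_fun_def)

lemma linear_plus_fun: "linear A \<Longrightarrow> linear B \<Longrightarrow> linear (A + B)"
  using linear_compose_add[of A B] by (simp add: plus_fun_def)

lemma linear_scaleR_fun: "linear A \<Longrightarrow> linear (c *\<^sub>R A)"
  using linear_compose_scale_right[of A c] by (simp add: scaleR_fun_def)

lemma op_functional_tensor: "linear h \<Longrightarrow> op_functional (tensor_functional h x)"
  by (simp add: op_functional_def tensor_functional_def linear_plus_fun linear_scaleR_fun
      linear_add linear_scale scaleR_fun_app)

text \<open>Evaluation in the unit ball followed by a norm-one functional has norm at most 1, and
  \<open>T\<close> itself attains the value 1.\<close>

lemma tensor_functional_in_JL:
  fixes T :: "real^3 \<Rightarrow> 'b::real_normed_vector"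
  assumes dim2: "dim (UNIV :: 'b set) = 2" and T: "linear T" "opnormX T = 1"
    and x: "supnorm x \<le> 1" "norm (T x) = 1" and h: "h \<in> JY (T x)"
  shows "tensor_functional h x \<in> JL T"
proof -
  have h': "linear h" "\<And>y. \<bar>h y\<bar> \<le> norm y" "h (T x) = 1"
    using h by (auto simp: JY_iff[OF dim2 x(2)])
  have "op_dual_norm (tensor_functional h x) = 1"
    unfolding op_dual_norm_def
  proof (rule cSup_eq_maximum)
    show "1 \<in> {\<bar>tensor_functional h x A\<bar> |A. linear A \<and> opnormX A \<le> 1}"
      using T h' by (auto simp: tensor_functional_def intro!: exI[of _ T])
    fix r assume "r \<in> {\<bar>tensor_functional h x A\<bar> |A. linear A \<and> opnormX A \<le> 1}"
    then obtain A where A: "linear A" "opnormX A \<le> 1" "r = \<bar>tensor_functional h x A\<bar>"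
      by blast
    have "r \<le> norm (A x)"
      using A h'(2) by (simp add: tensor_functional_def)
    also have "\<dots> \<le> 1"
      using norm_le_opnormX[OF A(1) x(1)] A(2) by simp
    finally show "r \<le> 1" .
  qed
  then show ?thesis
    using op_functional_tensor[OF h'(1)] T h' by (simp add: JL_def tensor_functional_def)
qed

lemma plane_dual_pair_exists:
  assumes dim2: "dim (UNIV :: 'b::real_normed_vector set) = 2"
  obtains f g :: "'b::real_normed_vector \<Rightarrow> real" and u v
  where "linear f" "linear g" "f u = 1" "f v = 0" "g u = 0" "g v = 1"
proof -
  obtain y :: 'b where "y \<notin> span {0}"
    using plane_second_vector[OF dim2] .
  then have "y \<noteq> 0"
    by auto
  then have "norm (y /\<^sub>R norm y) = 1"
    by simp
  then obtain f where f: "f \<in> JY (y /\<^sub>R norm y)"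
    using JY_nonempty[OF dim2] by blast
  then have lin: "linear f"
    by (simp add: JY_def)
  from extend_to_dual_pair[OF dim2 lin JY_nonzero[OF f]] show ?thesis
    using lin that by metis
qed

text \<open>\<open>op_dual_norm\<close> is a bare supremum, so the set behind it must first be shown
  bounded; the tensor expansion provides the bound.\<close>

lemma JL_bound:
  fixes T :: "real^3 \<Rightarrow> 'b::real_normed_vector"
  assumes dim2: "dim (UNIV :: 'b set) = 2" and \<Phi>: "\<Phi> \<in> JL T" and A: "linear A" "opnormX A \<le> 1"
  shows "\<Phi> A \<le> 1"
proof -
  obtain f g :: "'b \<Rightarrow> real" and u v
    where lin: "linear f" "linear g" and dual: "f u = 1" "f v = 0" "g u = 0" "g v = 1"
    using plane_dual_pair_exists[OF dim2] .
  obtain x x' where \<Phi>_eq: "\<Phi> = tensor_functional f x + tensor_functional g x'"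
    using op_functional_expansion[OF lin dual_pair_expansion[OF dim2 lin dual]] \<Phi>
    by (auto simp: JL_def)
  obtain K K' where K: "\<And>y. \<bar>f y\<bar> \<le> norm y * K" "\<And>y. \<bar>g y\<bar> \<le> norm y * K'" "0 \<le> K" "0 \<le> K'"
    using bounded_linear.nonneg_bounded[OF linear_functional_bounded[OF dim2 lin(1)]]
      bounded_linear.nonneg_bounded[OF linear_functional_bounded[OF dim2 lin(2)]]
    by (auto simp del: mult_minus_left)
  have "\<bar>\<Phi> B\<bar> \<le> (supnorm x + 1) * K + (supnorm x' + 1) * K'" if B: "linear B" "opnormX B \<le> 1" for B
  proof -
    have "\<bar>\<Phi> B\<bar> \<le> \<bar>f (B x)\<bar> + \<bar>g (B x')\<bar>"
      using B by (simp add: \<Phi>_eq tensor_functional_def)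
    also have "\<dots> \<le> norm (B x) * K + norm (B x') * K'"
      using K by (intro add_mono)
    also have "\<dots> \<le> (supnorm x + 1) * K + (supnorm x' + 1) * K'"
      using K norm_le_supnorm_mult[OF B] by (intro add_mono mult_right_mono)
    finally show ?thesis .
  qed
  then have "bdd_above {\<bar>\<Phi> A\<bar> |A. linear A \<and> opnormX A \<le> 1}"
    by (intro bdd_aboveI) auto
  then have "\<bar>\<Phi> A\<bar> \<le> op_dual_norm \<Phi>"
    unfolding op_dual_norm_def using A by (intro cSup_upper) auto
  then show ?thesis
    using \<Phi> by (simp add: JL_def)
qed

text \<open>
  If every functional supporting \<open>T x\<close> at a vertex \<open>x\<close> annihilates \<open>A x\<close>, then
  \<open>\<parallel>s T + A\<parallel> \<le> s + o(1)\<close> as \<open>s \<rightarrow> \<infinity>\<close>, so a functional supporting \<open>T\<close> annihilates \<open>A\<close>.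
\<close>

lemma JL_annihilates:
  fixes T :: "real^3 \<Rightarrow> 'b::real_normed_vector"
  assumes dim2: "dim (UNIV :: 'b set) = 2" and T: "linear T"
    and unit: "\<And>i. i \<in> {1..4} \<Longrightarrow> norm (T (xpt i)) = 1"
    and \<Phi>: "\<Phi> \<in> JL T" and A: "linear A"
    and ann: "\<And>i h. i \<in> {1..4} \<Longrightarrow> h \<in> JY (T (xpt i)) \<Longrightarrow> h (A (xpt i)) = 0"
  shows "\<Phi> A = 0"
proof -
  have opf: "op_functional \<Phi>" "\<Phi> T = 1"
    using \<Phi> by (auto simp: JL_def)
  \<comment> \<open>A one-sided estimate is enough, since it applies to \<open>A\<close> and to its
    negative.\<close>
  have nonpos: "\<Phi> B \<le> 0"
    if B: "linear B" "\<And>i h. i \<in> {1..4} \<Longrightarrow> h \<in> JY (T (xpt i)) \<Longrightarrow> h (B (xpt i)) = 0" for B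
  proof (rule field_le_epsilon)
    fix e :: real assume e: "0 < e"
    \<comment> \<open>The functional realizing the derivative of the norm in direction
      \<open>B (xpt i)\<close> is itself a supporting one, so the first-order term vanishes.\<close>
    have ev: "\<forall>\<^sub>F s in at_top. norm (s *\<^sub>R T (xpt i) + B (xpt i)) \<le> s + e" if i: "i \<in> {1..4}" for i
    proof (rule extremal_support_functional[OF dim2 unit[OF i], of "B (xpt i)"])
      fix h assume "linear h" "\<And>x. \<bar>h x\<bar> \<le> norm x" "h (T (xpt i)) = 1"
        and h: "\<And>e. e > 0 \<Longrightarrow> \<forall>\<^sub>F s in at_top. norm (s *\<^sub>R T (xpt i) + B (xpt i)) \<le> s + h (B (xpt i)) + e"
      then have "h \<in> JY (T (xpt i))"
        using JY_iff[OF dim2 unit[OF i]] by blast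
      then have "h (B (xpt i)) = 0"
        by (rule B(2)[OF i])
      then show ?thesis
        using h[OF e] by simp
    qed
    have "\<forall>\<^sub>F s in at_top. \<forall>i\<in>{1..4}. norm (s *\<^sub>R T (xpt i) + B (xpt i)) \<le> s + e"
      using ev by (intro eventually_ball_finite) auto
    then have "\<forall>\<^sub>F s in at_top. 0 < s \<and> (\<forall>i\<in>{1..4}. norm (s *\<^sub>R T (xpt i) + B (xpt i)) \<le> s + e)"
      by (rule eventually_conj[OF eventually_gt_at_top])
    then obtain s where s: "0 < s" "\<And>i. i \<in> {1..4} \<Longrightarrow> norm (s *\<^sub>R T (xpt i) + B (xpt i)) \<le> s + e"
      using eventually_happens'[OF trivial_limit_at_top_linorder] by force
    \<comment> \<open>Dividing by \<open>s + e\<close> brings \<open>s *\<^sub>R T + B\<close> into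
      the unit ball, where \<open>\<Phi>\<close> is at most 1; as \<open>\<Phi> T = 1\<close>, this
      reads \<open>s + \<Phi> B \<le> s + e\<close>.\<close>
    define C where "C = (1 / (s + e)) *\<^sub>R (s *\<^sub>R T + B)"
    have lin: "linear (s *\<^sub>R T)" "linear (s *\<^sub>R T + B)" "linear C"
      using T B(1) by (simp_all add: C_def linear_plus_fun linear_scaleR_fun)
    have "opnormX C \<le> 1"
    proof (rule opnormX_le[OF lin(3)])
      fix i :: nat assume "i \<in> {1..4}"
      then show "norm (C (xpt i)) \<le> 1"
        using s e by (simp add: C_def scaleR_fun_app)
    qed
    then have "\<Phi> C \<le> 1"
      using JL_bound[OF dim2 \<Phi> lin(3)] by simp
    moreover have "\<Phi> C = (1 / (s + e)) * \<Phi> (s *\<^sub>R T + B)"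
      unfolding C_def using opf lin unfolding op_functional_def by blast
    moreover have "\<Phi> (s *\<^sub>R T + B) = \<Phi> (s *\<^sub>R T) + \<Phi> B"
      using opf lin B unfolding op_functional_def by blast
    moreover have "\<Phi> (s *\<^sub>R T) = s * \<Phi> T"
      using opf T unfolding op_functional_def by blast
    ultimately have "(s + \<Phi> B) / (s + e) \<le> 1"
      using opf by simp
    then show "\<Phi> B \<le> 0 + e"
      using s e by (simp add: field_simps)
  qed
  have "linear ((- 1) *\<^sub>R A)"
    using A by (rule linear_scaleR_fun)
  moreover have "h (((- 1) *\<^sub>R A) (xpt i)) = 0" if "i \<in> {1..4}" "h \<in> JY (T (xpt i))" for i h
    using ann[OF that] that(2) by (simp add: scaleR_fun_app JY_def linear_neg)
  ultimately have "\<Phi> ((- 1) *\<^sub>R A) \<le> 0"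
    by (rule nonpos)
  moreover have "\<Phi> ((- 1) *\<^sub>R A) = (- 1) * \<Phi> A"
    using opf A unfolding op_functional_def by blast
  moreover have "\<Phi> A \<le> 0"
    using A ann by (rule nonpos)
  ultimately show ?thesis
    by simp
qed

lemma dim_image_inj:
  fixes f :: "'a::euclidean_space \<Rightarrow> 'c::real_vector"
  assumes "linear f" "inj f"
  shows "dim (f ` V) = dim V"
proof -
  obtain B where B: "B \<subseteq> V" "independent B" "V \<subseteq> span B" "card B = dim V"
    using basis_exists .
  show ?thesis
  proof (rule dim_unique)
    show "f ` B \<subseteq> f ` V"
      using B by blast
    show "f ` V \<subseteq> span (f ` B)"
      using B linear_span_image[OF assms(1)] by blast
    show "independent (f ` B)"
      using linear_independent_injective_image[OF assms(1) B(2) inj_on_subset[OF assms(2) subset_UNIV]] .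
    show "card (f ` B) = dim V"
      using B(4) card_image[OF inj_on_subset[OF assms(2) subset_UNIV]] by metis
  qed
qed

text \<open>The map \<open>\<Psi>\<close> identifies pairs of points with functionals, and the span
  of \<open>JL T\<close> is the image of \<open>P \<times> Q\<close>. One inclusion comes from
  tensors at vertices, the other from annihilation of suitable rank-one operators.\<close>

lemma dim_span_JL:
  fixes T :: "real^3 \<Rightarrow> 'b::real_normed_vector"
  assumes dim2: "dim (UNIV :: 'b set) = 2" and T: "linear T" "opnormX T = 1"
    and unit: "\<And>i. i \<in> {1..4} \<Longrightarrow> norm (T (xpt i)) = 1"
    and lin: "linear f" "linear g" and dual: "f u = 1" "f v = 0" "g u = 0" "g v = 1"
    and I: "I \<subseteq> {1..4}" "\<And>i. i \<in> I \<Longrightarrow> f \<in> span (JY (T (xpt i)))"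
      "\<And>i h. i \<in> {1..4} - I \<Longrightarrow> h \<in> JY (T (xpt i)) \<Longrightarrow> h u = 0"
    and J: "J \<subseteq> {1..4}" "\<And>i. i \<in> J \<Longrightarrow> g \<in> span (JY (T (xpt i)))"
      "\<And>i h. i \<in> {1..4} - J \<Longrightarrow> h \<in> JY (T (xpt i)) \<Longrightarrow> h v = 0"
  shows "dim (span (JL T)) = dim (xpt ` I) + dim (xpt ` J)"
proof -
  define P where "P = span (xpt ` I)"
  define Q where "Q = span (xpt ` J)"
  define \<Psi> where "\<Psi> p = tensor_functional f (fst p) + tensor_functional g (snd p)" for p :: "(real^3) \<times> (real^3)"
  note tlin = linear_tensor_functional_right[OF lin(1)] linear_tensor_functional_right[OF lin(2)]
  have "linear \<Psi>"
    using tlin by (simp add: linear_iff \<Psi>_def algebra_simps)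
  have rank_one: "linear (\<lambda>y. (x \<bullet> y) *\<^sub>R w)" for x :: "real^3" and w :: 'b
    by (auto simp: linear_iff algebra_simps inner_add_right)
  \<comment> \<open>Rank-one operators with range along \<open>u\<close> or \<open>v\<close> read
    off the two components of a functional, which gives injectivity of
    \<open>\<Psi>\<close>.\<close>
  have eval: "\<Psi> p (\<lambda>y. (x \<bullet> y) *\<^sub>R u) = x \<bullet> fst p" "\<Psi> p (\<lambda>y. (x \<bullet> y) *\<^sub>R v) = x \<bullet> snd p" for p x
    using lin dual by (simp_all add: \<Psi>_def tensor_functional_def rank_one linear_scale)
  have "inj \<Psi>"
    unfolding linear_injective_0[OF \<open>linear \<Psi>\<close>]
  proof (intro allI impI)
    fix p assume "\<Psi> p = 0"
    then have "fst p \<bullet> fst p = 0" "snd p \<bullet> snd p = 0"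
      using eval[of p] by (metis zero_fun_apply)+
    then show "p = 0"
      by (simp add: prod_eq_iff)
  qed
  have tensor_span: "tensor_functional h x \<in> span (JL T)"
    if K: "K \<subseteq> {1..4}" "linear h" "\<And>i. i \<in> K \<Longrightarrow> h \<in> span (JY (T (xpt i)))"
      and x: "x \<in> span (xpt ` K)" for h x K
  proof -
    have "tensor_functional h (xpt i) \<in> span (JL T)" if "i \<in> K" for i
    proof -
      have i: "i \<in> {1..4}"
        using K that by blast
      have "(\<lambda>h. tensor_functional h (xpt i)) ` JY (T (xpt i)) \<subseteq> JL T"
        using tensor_functional_in_JL[OF dim2 T supnorm_xpt[OF i] unit[OF i]] by blast
      then have "span ((\<lambda>h. tensor_functional h (xpt i)) ` JY (T (xpt i))) \<subseteq> span (JL T)"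
        by (rule span_mono)
      then show ?thesis
        using K(3)[OF that] unfolding linear_span_image[OF linear_tensor_functional] by blast
    qed
    then have "span (tensor_functional h ` (xpt ` K)) \<subseteq> span (JL T)"
      by (intro span_minimal) auto
    then show ?thesis
      using x unfolding linear_span_image[OF linear_tensor_functional_right[OF K(2)]] by blast
  qed
  have "\<Psi> ` (P \<times> Q) \<subseteq> span (JL T)"
    using tensor_span[OF I(1) lin(1) I(2)] tensor_span[OF J(1) lin(2) J(2)]
    by (auto simp: \<Psi>_def P_def Q_def intro!: span_add)
  moreover have "JL T \<subseteq> \<Psi> ` (P \<times> Q)"
  proof
    fix \<Phi> assume \<Phi>: "\<Phi> \<in> JL T"
    then have "op_functional \<Phi>"
      by (simp add: JL_def)
    then obtain x x' where "\<Phi> = tensor_functional f x + tensor_functional g x'"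
      using op_functional_expansion[OF lin dual_pair_expansion[OF dim2 lin dual]] by blast
    then have \<Phi>_eq: "\<Phi> = \<Psi> (x, x')"
      by (simp add: \<Psi>_def)
    \<comment> \<open>Let \<open>z\<close> be the part of \<open>y\<close> orthogonal to the
      vertices indexed by \<open>K\<close>. In the rank-one operator of \<open>z\<close> and
      \<open>w\<close> the scalar vanishes at those vertices, and supporting functionals at the
      others kill \<open>w\<close>; hence \<open>\<Phi>\<close> annihilates it and
      \<open>z \<bullet> z = 0\<close>.\<close>
    have in_span: "y \<in> span (xpt ` K)"
      if K: "K \<subseteq> {1..4}" "\<And>i h. i \<in> {1..4} - K \<Longrightarrow> h \<in> JY (T (xpt i)) \<Longrightarrow> h w = 0"
        and y: "\<And>z. \<Phi> (\<lambda>y. (z \<bullet> y) *\<^sub>R w) = z \<bullet> y" for K w y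
    proof (rule ccontr)
      assume no: "y \<notin> span (xpt ` K)"
      obtain y1 z where yz: "y1 \<in> span (xpt ` K)" "\<And>t. t \<in> span (xpt ` K) \<Longrightarrow> orthogonal z t" "y = y1 + z"
        using orthogonal_subspace_decomp_exists[of "xpt ` K" y] by metis
      have "\<Phi> (\<lambda>y. (z \<bullet> y) *\<^sub>R w) = 0"
      proof (rule JL_annihilates[OF dim2 T(1) unit \<Phi> rank_one])
        fix i h assume i: "i \<in> {1..4}" and h: "h \<in> JY (T (xpt i))"
        show "h ((z \<bullet> xpt i) *\<^sub>R w) = 0"
        proof (cases "i \<in> K")
          case True
          then have "z \<bullet> xpt i = 0"
            using yz(2) by (simp add: orthogonal_def span_base)
          then show ?thesis
            using h by (simp add: JY_def linear_0)
        next
          case False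
          then show ?thesis
            using K(2)[OF _ h] h i by (simp add: JY_def linear_scale)
        qed
      qed
      then have "z \<bullet> (y1 + z) = 0"
        using y yz(3) by simp
      moreover have "z \<bullet> y1 = 0"
        using yz(1,2) by (simp add: orthogonal_def)
      ultimately have "z = 0"
        by (simp add: inner_add_right)
      then show False
        using no yz by simp
    qed
    have \<Phi>_eval: "\<Phi> (\<lambda>y. (z \<bullet> y) *\<^sub>R u) = z \<bullet> x" "\<Phi> (\<lambda>y. (z \<bullet> y) *\<^sub>R v) = z \<bullet> x'" for z
      using eval[of "(x, x')" z] by (simp_all add: \<Phi>_eq)
    have "x \<in> P"
      unfolding P_def using I(1,3) \<Phi>_eval(1) by (rule in_span)
    moreover have "x' \<in> Q"
      unfolding Q_def using J(1,3) \<Phi>_eval(2) by (rule in_span)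
    ultimately show "\<Phi> \<in> \<Psi> ` (P \<times> Q)"
      using \<Phi>_eq by blast
  qed
  moreover have "subspace (\<Psi> ` (P \<times> Q))"
    by (intro linear_subspace_image[OF \<open>linear \<Psi>\<close>] subspace_Times) (simp_all add: P_def Q_def)
  ultimately have "span (JL T) = \<Psi> ` (P \<times> Q)"
    by (meson span_minimal subset_antisym)
  then have "dim (span (JL T)) = dim (P \<times> Q)"
    using dim_image_inj[OF \<open>linear \<Psi>\<close> \<open>inj \<Psi>\<close>] by metis
  also have "\<dots> = dim P + dim Q"
    by (intro dim_Times) (simp_all add: P_def Q_def)
  finally show ?thesis
    by (simp add: P_def Q_def)
qed

section \<open>The order of smoothness\<close>

lemma inj_on_xpt: "inj_on xpt {1..4}"
  unfolding exhaust_4_interval by (auto simp: inj_on_def xpt_def vec_eq_iff forall_3)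

lemma span_xpt: "span (xpt ` {1..4}) = UNIV"
proof -
  have "x \<in> span (xpt ` {1..4})" for x
  proof -
    \<comment> \<open>The two differences and the sum are twice the three unit coordinate
      vectors.\<close>
    have "x = (x $ 1 / 2) *\<^sub>R (xpt 1 - xpt 2) + (x $ 2 / 2) *\<^sub>R (xpt 2 - xpt 3) + (x $ 3 / 2) *\<^sub>R (xpt 1 + xpt 3)"
      by (simp add: xpt_def vec_eq_iff forall_3)
    also have "\<dots> \<in> span (xpt ` {1..4})"
      by (intro span_add span_diff span_scale span_base imageI) auto
    finally show ?thesis .
  qed
  then show ?thesis
    by auto
qed

text \<open>The relation between the four vertices recovers the omitted one, so the other three span
  the space and are independent by counting.\<close>

lemma independent_xpt:
  assumes j: "j \<in> {1..4}"
  shows "independent (xpt ` ({1..4} - {j}))"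
proof -
  let ?B = "xpt ` ({1..4} - {j})"
  have base: "i \<in> {1..4} \<Longrightarrow> i \<noteq> j \<Longrightarrow> xpt i \<in> span ?B" for i
    by (intro span_base imageI) auto
  have "xpt j \<in> span ?B"
  proof -
    have eqs: "xpt 1 = xpt 2 + xpt 4 - xpt 3" "xpt 2 = xpt 1 + xpt 3 - xpt 4"
      "xpt 3 = xpt 2 + xpt 4 - xpt 1" "xpt 4 = xpt 1 + xpt 3 - xpt 2"
      using xpt_relation by (simp_all add: algebra_simps)
    consider "j = 1" | "j = 2" | "j = 3" | "j = 4"
      using j unfolding exhaust_4_interval by blast
    then show ?thesis
    proof cases
      case 1
      have "xpt 2 + xpt 4 - xpt 3 \<in> span ?B"
        by (intro span_add span_diff base) (auto simp: 1)
      then show ?thesis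
        unfolding 1 eqs(1)[symmetric] .
    next
      case 2
      have "xpt 1 + xpt 3 - xpt 4 \<in> span ?B"
        by (intro span_add span_diff base) (auto simp: 2)
      then show ?thesis
        unfolding 2 eqs(2)[symmetric] .
    next
      case 3
      have "xpt 2 + xpt 4 - xpt 1 \<in> span ?B"
        by (intro span_add span_diff base) (auto simp: 3)
      then show ?thesis
        unfolding 3 eqs(3)[symmetric] .
    next
      case 4
      have "xpt 1 + xpt 3 - xpt 2 \<in> span ?B"
        by (intro span_add span_diff base) (auto simp: 4)
      then show ?thesis
        unfolding 4 eqs(4)[symmetric] .
    qed
  qed
  then have "xpt ` {1..4} \<subseteq> span ?B"
    using base by blast
  then have "UNIV \<subseteq> span ?B"
    using span_xpt span_minimal[OF _ subspace_span] by blast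
  moreover have "card ?B = 3"
    using j by (subst card_image) (auto intro: inj_on_subset[OF inj_on_xpt])
  ultimately show ?thesis
    by (intro card_le_dim_spanning[of _ UNIV]) (auto simp: dim_UNIV)
qed

lemma dim_xpt:
  assumes "N \<subseteq> {1..4}"
  shows "dim (xpt ` N) = min 3 (card N)"
proof (cases "N = {1..4}")
  case True
  have "dim (xpt ` {1..4}) = dim (UNIV :: (real^3) set)"
    using span_xpt by (metis dim_span)
  then show ?thesis
    using True by (simp add: dim_UNIV)
next
  case False
  then obtain j where j: "j \<in> {1..4}" "N \<subseteq> {1..4} - {j}"
    using assms by blast
  have "independent (xpt ` N)"
    by (rule independent_mono[OF independent_xpt[OF j(1)] image_mono[OF j(2)]])
  then have "dim (xpt ` N) = card (xpt ` N)"
    by (rule dim_eq_card_independent)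
  also have "\<dots> = card N"
    by (rule card_image[OF inj_on_subset[OF inj_on_xpt assms]])
  finally show ?thesis
    using card_mono[OF _ j(2)] j(1) by simp
qed

section \<open>Segments of the unit sphere and common supporting functionals\<close>

text \<open>A functional supporting the midpoint must be 1 at both ends; conversely, a common
  supporting functional is 1 along the whole segment and keeps its norm at 1.\<close>

lemma same_segment_iff:
  fixes a b :: "'b::real_normed_vector"
  assumes dim2: "dim (UNIV :: 'b set) = 2" and unit: "norm a = 1" "norm b = 1"
  shows "same_segment a b \<longleftrightarrow> (\<exists>f. f \<in> JY a \<and> f \<in> JY b)"
proof
  assume "same_segment a b"
  then obtain p q where pq: "closed_segment p q \<subseteq> sphere 0 1" "a \<in> closed_segment p q" "b \<in> closed_segment p q"
    by (auto simp: same_segment_def)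
  have "midpoint a b \<in> closed_segment a b"
    by simp
  also have "\<dots> \<subseteq> closed_segment p q"
    using pq by (simp add: closed_segment_subset)
  also have "\<dots> \<subseteq> sphere 0 1"
    by (rule pq)
  finally have m: "norm (midpoint a b) = 1"
    by simp
  obtain f where "f \<in> JY (midpoint a b)"
    using JY_nonempty[OF dim2 m] .
  then have f: "linear f" "\<And>x. \<bar>f x\<bar> \<le> norm x" "f (midpoint a b) = 1"
    using JY_iff[OF dim2 m] by auto
  have "f a + f b = 2"
    using f by (simp add: midpoint_def linear_add linear_scale)
  then have "f a = 1" "f b = 1"
    using f(2)[of a] f(2)[of b] unit by linarith+
  then show "\<exists>f. f \<in> JY a \<and> f \<in> JY b"
    using f unit by (auto simp: JY_iff[OF dim2])
next
  assume "\<exists>f. f \<in> JY a \<and> f \<in> JY b"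
  then obtain f where f: "linear f" "\<And>x. \<bar>f x\<bar> \<le> norm x" "f a = 1" "f b = 1"
    using unit by (auto simp: JY_iff[OF dim2])
  have "norm x = 1" if "x \<in> closed_segment a b" for x
  proof (rule antisym)
    obtain t where t: "0 \<le> t" "t \<le> 1" "x = (1 - t) *\<^sub>R a + t *\<^sub>R b"
      using \<open>x \<in> closed_segment a b\<close> by (auto simp: in_segment)
    show "norm x \<le> 1"
      using norm_triangle_ineq[of "(1 - t) *\<^sub>R a" "t *\<^sub>R b"] t unit by simp
    have "f x = 1"
      using f t(3) by (simp add: linear_add linear_scale)
    then show "1 \<le> norm x"
      using f(2)[of x] by simp
  qed
  then have "closed_segment a b \<subseteq> sphere 0 1"
    by auto
  then show "same_segment a b"
    unfolding same_segment_def by (intro exI[of _ a] exI[of _ b]) auto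
qed

text \<open>Both functionals have norm one, so the factor \<open>c\<close> is 1 or -1, and its sign
  selects \<open>b\<close> or \<open>- b\<close>.\<close>

lemma parallel_support_functionals:
  fixes a b :: "'b::real_normed_vector"
  assumes dim2: "dim (UNIV :: 'b set) = 2" and unit: "norm a = 1" "norm b = 1"
    and h: "h \<in> JY a" and k: "k \<in> JY b" and par: "h = c *\<^sub>R k"
  shows "h \<in> JY b \<or> h \<in> JY (- b)"
proof -
  have h': "linear h" "\<And>x. \<bar>h x\<bar> \<le> norm x" "h a = 1"
    using h JY_iff[OF dim2 unit(1)] by auto
  have k': "\<And>x. \<bar>k x\<bar> \<le> norm x" "k b = 1"
    using k JY_iff[OF dim2 unit(2)] by auto
  have ca: "1 = c * k a" and cb: "h b = c"
    using par h' k' by (auto simp: scaleR_fun_def)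
  have "\<bar>c\<bar> \<le> 1"
    using h'(2)[of b] cb unit by simp
  moreover have "1 \<le> \<bar>c\<bar>"
  proof -
    have "\<bar>c\<bar> * \<bar>k a\<bar> = 1"
      using ca by (metis abs_mult abs_one)
    moreover have "\<bar>c\<bar> * \<bar>k a\<bar> \<le> \<bar>c\<bar> * 1"
      using k'(1)[of a] unit by (intro mult_left_mono) auto
    ultimately show ?thesis
      by simp
  qed
  ultimately have "h b = 1 \<or> h (- b) = 1"
    using cb h'(1) by (auto simp: linear_neg)
  then show ?thesis
    using h' unit by (auto simp: JY_iff[OF dim2])
qed

lemma unit_vectors_of_line:
  fixes V :: "'b::real_normed_vector set"
  assumes "dim V = 1" "a \<in> V" "b \<in> V" "norm a = 1" "norm b = 1"
  shows "a = b \<or> a = - b"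
proof -
  obtain B where B: "V \<subseteq> span B" "card B = 1"
    using basis_exists[of V] assms(1) by metis
  then obtain p where "B = {p}"
    using card_1_singletonE by blast
  then have "a \<in> span {p}" "b \<in> span {p}"
    using B(1) assms(2,3) by auto
  then obtain s t where st: "a = s *\<^sub>R p" "b = t *\<^sub>R p"
    unfolding span_singleton by blast
  have "\<bar>s\<bar> * norm p = \<bar>t\<bar> * norm p" "norm p \<noteq> 0"
    using assms(4,5) st by auto
  then have "s = t \<or> s = - t"
    by (simp add: abs_eq_iff)
  then show ?thesis
    using st by auto
qed

theorem theorem3p9:
  fixes T :: "real^3 \<Rightarrow> 'b::banach"
  assumes dimY: "dim (UNIV :: 'b set) = 2"
    and linT: "linear T"
    and normT: "opnormX T = 1"
    and MT_Ext: "MT T \<inter> ExtBX = {xpt 1, - xpt 1, xpt 2, - xpt 2, xpt 3, - xpt 3, xpt 4, - xpt 4}"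
  shows "(card (S1 T) = 4 \<longrightarrow>
            ((dim (range T) = 1 \<or>
              (\<forall>i\<in>{1..4}. \<forall>j\<in>{1..4}. i \<noteq> j \<longrightarrow>
                 same_segment (T (xpt i)) (T (xpt j)) \<or> same_segment (T (xpt i)) (- T (xpt j))))
               \<longrightarrow> k_smooth 3 T) \<and>
            (\<not> (dim (range T) = 1 \<or>
              (\<forall>i\<in>{1..4}. \<forall>j\<in>{1..4}. i \<noteq> j \<longrightarrow>
                 same_segment (T (xpt i)) (T (xpt j)) \<or> same_segment (T (xpt i)) (- T (xpt j))))
               \<longrightarrow> k_smooth 4 T))
       \<and> (card (S1 T) = 3 \<longrightarrow> k_smooth 4 T)
       \<and> (card (S1 T) = 2 \<longrightarrow> k_smooth 5 T)
       \<and> (card (S1 T) < 2 \<longrightarrow> S1 T = {} \<and> k_smooth 6 T)"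
proof -
  define y where "y i = T (xpt i)" for i
  \<comment> \<open>The count runs over nonsmooth images, since these are the vertices that
    contribute a second functional.\<close>
  define N where "N = {i \<in> {1..4}. \<not> smooth_pt (y i)}"
  have N: "N \<subseteq> {1..4}" "finite N"
    by (auto simp: N_def)
  have unit: "norm (y i) = 1" if "i \<in> {1..4}" for i
  proof -
    have "xpt i \<in> MT T \<inter> ExtBX"
      using that unfolding MT_Ext exhaust_4_interval by auto
    then show ?thesis
      using normT by (simp add: MT_def y_def)
  qed
  have sum: "y 1 + y 3 = y 2 + y 4"
    unfolding y_def linear_add[OF linT, symmetric] xpt_relation ..
  have S1_eq: "S1 T = xpt ` ({1..4} - N)"
    by (auto simp: S1_def N_def y_def)
  have card_S1: "card (S1 T) = 4 - card N"
    unfolding S1_eq using N inj_on_subset[OF inj_on_xpt Diff_subset]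
    by (subst card_image) (auto simp: card_Diff_subset)
  have un: "norm (y 1) = 1" "norm (y 2) = 1" "norm (y 3) = 1" "norm (y 4) = 1"
    by (auto intro!: unit)
  \<comment> \<open>Exactly one smooth image is impossible, which yields the emptiness claim of the
    last case.\<close>
  have three: "card N \<noteq> 3"
  proof
    assume "card N = 3"
    then have "card ({1..4} - N) = 1"
      using N by (simp add: card_Diff_subset)
    then obtain j where "{1..4} - N = {j}"
      using card_1_singletonE by blast
    then have "j \<in> {1..4} - N" "\<And>i. i \<in> {1..4} \<Longrightarrow> i \<noteq> j \<Longrightarrow> i \<in> N"
      by blast+
    then have j: "j \<in> {1..4}" "smooth_pt (y j)" "\<And>i. i \<in> {1..4} \<Longrightarrow> i \<noteq> j \<Longrightarrow> \<not> smooth_pt (y i)"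
      unfolding N_def by blast+
    consider "j = 1" | "j = 2" | "j = 3" | "j = 4"
      using j(1) unfolding exhaust_4_interval by blast
    then show False
    proof cases
      case 1
      have "\<not> smooth_pt (y 1)"
        using sum j(3) un 1 by (intro nonsmooth_parallelogram[OF dimY, of "y 2" "y 3" "y 4" "y 1"]) (auto simp: add.commute)
      then show ?thesis
        using j 1 by simp
    next
      case 2
      have "\<not> smooth_pt (y 2)"
        using sum j(3) un 2 by (intro nonsmooth_parallelogram[OF dimY, of "y 3" "y 4" "y 1" "y 2"]) (auto simp: add.commute)
      then show ?thesis
        using j 2 by simp
    next
      case 3
      have "\<not> smooth_pt (y 3)"
        using sum j(3) un 3 by (intro nonsmooth_parallelogram[OF dimY, of "y 4" "y 1" "y 2" "y 3"]) (auto simp: add.commute)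
      then show ?thesis
        using j 3 by simp
    next
      case 4
      have "\<not> smooth_pt (y 4)"
        using sum j(3) un 4 by (intro nonsmooth_parallelogram[OF dimY, of "y 1" "y 2" "y 3" "y 4"]) auto
      then show ?thesis
        using j 4 by simp
    qed
  qed
  have unit': "norm (T (xpt i)) = 1" if "i \<in> {1..4}" for i
    using unit[OF that] by (simp add: y_def)
  define common where "common \<longleftrightarrow> (\<exists>f. f \<noteq> 0 \<and> (\<forall>i\<in>{1..4}. f \<in> span (JY (y i))))"
  \<comment> \<open>The common \<open>f\<close> contributes the span of all four vertices, of
    dimension 3; a complementary \<open>g\<close> contributes the vertices with nonsmooth image,
    where the span is the whole dual.\<close>
  have dim_common: "dim (span (JL T)) = 3 + min 3 (card N)" if com: common
  proof -
    obtain f where f: "f \<noteq> 0" "\<And>i. i \<in> {1..4} \<Longrightarrow> f \<in> span (JY (y i))"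
      using com unfolding common_def by blast
    have "1 \<in> {1..4::nat}"
      by simp
    then have "linear f"
      using f(2) linear_of_span_JY by blast
    obtain g :: "'b \<Rightarrow> real" and u v where g: "linear g" and dual: "f u = 1" "f v = 0" "g u = 0" "g v = 1"
      using extend_to_dual_pair[OF dimY \<open>linear f\<close> f(1)] .
    have "dim (span (JL T)) = dim (xpt ` {1..4}) + dim (xpt ` N)"
    proof (rule dim_span_JL[where f = f and g = g and u = u and v = v])
      show "f \<in> span (JY (T (xpt i)))" if "i \<in> {1..4}" for i
        using f(2)[OF that] by (simp add: y_def)
      show "g \<in> span (JY (T (xpt i)))" if "i \<in> N" for i
        using that g unit' by (auto simp: N_def y_def intro!: nonsmooth_span_JY[OF dimY])
      \<comment> \<open>At a smooth image \<open>f\<close> is a multiple of the only supporting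
        functional \<open>h\<close>, nonzero because \<open>f u = 1\<close>; so
        \<open>f v = 0\<close> passes to \<open>h\<close>.\<close>
      show "h v = 0" if i: "i \<in> {1..4} - N" and h: "h \<in> JY (T (xpt i))" for i h
      proof -
        have "smooth_pt (y i)"
          using i by (simp add: N_def)
        then have "JY (y i) = {h}"
          using h by (auto simp: smooth_pt_def y_def)
        then have "f \<in> span {h}"
          using f(2)[of i] i by simp
        then obtain c where "f = c *\<^sub>R h"
          unfolding span_singleton by blast
        then show ?thesis
          using dual by (auto simp: scaleR_fun_app)
      qed
    qed (fact dimY linT normT unit' \<open>linear f\<close> g dual N(1) | simp)+
    then show ?thesis
      using dim_xpt[of "{1..4}"] dim_xpt[OF N(1)] by simp
  qed
  have pairs: "N = {} \<and> dim (span (JL T)) = 4" if "\<not> common"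
  proof (rule span_JY_parallelogram[OF dimY unit sum])
    fix f assume "f \<noteq> 0" "\<And>i. i \<in> {1..4} \<Longrightarrow> f \<in> span (JY (y i))"
    then show ?thesis
      using that by (auto simp: common_def)
  next
    fix f g I
    assume lin: "linear f" "linear g" and ind: "f \<notin> span {g}" "g \<notin> span {f}"
      and I: "I \<subseteq> {1..4}" "card I = 2"
        "\<And>i. i \<in> I \<Longrightarrow> span (JY (y i)) = span {f}"
        "\<And>i. i \<in> {1..4} - I \<Longrightarrow> span (JY (y i)) = span {g}"
    \<comment> \<open>A nonsmooth image would put both \<open>f\<close> and \<open>g\<close> into a
      single line.\<close>
    have "smooth_pt (y i)" if "i \<in> {1..4}" for i
    proof (rule ccontr)
      assume "\<not> smooth_pt (y i)"
      then have "f \<in> span (JY (y i))" "g \<in> span (JY (y i))"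
        using nonsmooth_span_JY[OF dimY unit[OF that]] lin by auto
      then show False
        using I(3,4)[of i] that ind by (cases "i \<in> I") auto
    qed
    then have "N = {}"
      by (auto simp: N_def)
    obtain u v where dual: "f u = 1" "f v = 0" "g u = 0" "g v = 1"
      using dual_pair[OF lin ind] .
    have f_type: "h v = 0" if "i \<in> I" "h \<in> JY (y i)" for i h
    proof -
      have "h \<in> span {f}"
        using I(3)[OF that(1)] span_base[OF that(2)] by simp
      then show ?thesis
        using dual by (auto simp: span_singleton scaleR_fun_app)
    qed
    have g_type: "h u = 0" if "i \<in> {1..4} - I" "h \<in> JY (y i)" for i h
    proof -
      have "h \<in> span {g}"
        using I(4)[OF that(1)] span_base[OF that(2)] by simp
      then show ?thesis
        using dual by (auto simp: span_singleton scaleR_fun_app)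
    qed
    \<comment> \<open>Each functional belongs to two vertices, and two vertices are independent: the
      order is 2 + 2.\<close>
    have "dim (span (JL T)) = dim (xpt ` I) + dim (xpt ` ({1..4} - I))"
    proof (rule dim_span_JL[where f = f and g = g and u = u and v = v])
      show "f \<in> span (JY (T (xpt i)))" if "i \<in> I" for i
        using I(3)[OF that] by (simp add: y_def span_base)
      show "g \<in> span (JY (T (xpt i)))" if "i \<in> {1..4} - I" for i
        using I(4)[OF that] by (simp add: y_def span_base)
      show "h u = 0" if "i \<in> {1..4} - I" "h \<in> JY (T (xpt i))" for i h
        using g_type[of i h] that by (simp add: y_def)
      show "h v = 0" if "i \<in> {1..4} - ({1..4} - I)" "h \<in> JY (T (xpt i))" for i h
        using f_type[of i h] that by (simp add: y_def)
    qed (fact dimY linT normT unit' lin dual I(1) | simp)+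
    moreover have "card ({1..4} - I) = 2"
      using I finite_subset[OF I(1)] by (simp add: card_Diff_subset)
    ultimately have "dim (span (JL T)) = 4"
      using dim_xpt[OF I(1)] dim_xpt[of "{1..4} - I"] I(2) by simp
    then show ?thesis
      using \<open>N = {}\<close> by simp
  qed
  let ?seg = "\<forall>i\<in>{1..4}. \<forall>j\<in>{1..4}. i \<noteq> j \<longrightarrow>
    same_segment (T (xpt i)) (T (xpt j)) \<or> same_segment (T (xpt i)) (- T (xpt j))"
  \<comment> \<open>Unit vectors on a line agree up to sign, so rank one is a special case of the
    segment condition.\<close>
  have rank1: ?seg if "dim (range T) = 1"
  proof (intro ballI impI)
    fix i j :: nat assume ij: "i \<in> {1..4}" "j \<in> {1..4}"
    have refl: "same_segment (y i) (y i)"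
      using same_segment_iff[OF dimY unit[OF ij(1)] unit[OF ij(1)]] JY_nonempty[OF dimY unit[OF ij(1)]] by blast
    have "y i = y j \<or> y i = - y j"
      using unit_vectors_of_line[OF that _ _ unit[OF ij(1)] unit[OF ij(2)]] by (simp add: y_def)
    then show "same_segment (T (xpt i)) (T (xpt j)) \<or> same_segment (T (xpt i)) (- T (xpt j))"
      using refl unfolding y_def by auto
  qed
  \<comment> \<open>When all images are smooth, the segment condition amounts to a common
    functional; comparing each image with the first already produces it.\<close>
  have seg_common: common if seg: ?seg and "N = {}"
  proof -
    have one: "1 \<in> {1..4::nat}"
      by simp
    have "smooth_pt (y 1)"
      using \<open>N = {}\<close> one unfolding N_def by blast
    then obtain h where h: "JY (y 1) = {h}"
      by (auto simp: smooth_pt_def)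
    have "h \<in> span (JY (y i))" if i: "i \<in> {1..4}" for i
    proof (cases "i = 1")
      case True
      then show ?thesis
        using h by (simp add: span_base)
    next
      case False
      then have "same_segment (y 1) (y i) \<or> same_segment (y 1) (- y i)"
        using seg one i unfolding y_def by metis
      then have "h \<in> JY (y i) \<or> h \<in> JY (- y i)"
        using same_segment_iff[OF dimY unit[OF one], of "y i"] same_segment_iff[OF dimY unit[OF one], of "- y i"]
          unit[OF i] h by auto
      then show ?thesis
        using span_base span_JY_minus by metis
    qed
    then show ?thesis
      using JY_nonzero[of h "y 1"] h by (auto simp: common_def)
  qed
  \<comment> \<open>Conversely, the unique supporting functionals at two images are both
    proportional to the common one, hence equal up to sign.\<close>
  have common_seg: ?seg if common and "N = {}"
  proof (intro ballI impI)
    fix i j :: nat assume ij: "i \<in> {1..4}" "j \<in> {1..4}"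
    obtain f where f: "f \<noteq> 0" "\<And>i. i \<in> {1..4} \<Longrightarrow> f \<in> span (JY (y i))"
      using \<open>common\<close> by (auto simp: common_def)
    obtain h where h: "JY (y i) = {h}"
      using \<open>N = {}\<close> ij unfolding N_def smooth_pt_def by blast
    obtain k where k: "JY (y j) = {k}"
      using \<open>N = {}\<close> ij unfolding N_def smooth_pt_def by blast
    obtain s where s: "f = s *\<^sub>R h"
      using f(2)[OF ij(1)] unfolding h span_singleton by blast
    obtain t where t: "f = t *\<^sub>R k"
      using f(2)[OF ij(2)] unfolding k span_singleton by blast
    have "s \<noteq> 0"
      using f(1) s by auto
    then have "h = (1 / s) *\<^sub>R f"
      using s by simp
    then have "h = (t / s) *\<^sub>R k"
      using t by simp
    then have "h \<in> JY (y j) \<or> h \<in> JY (- y j)"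
      using parallel_support_functionals[OF dimY unit[OF ij(1)] unit[OF ij(2)]] h k by blast
    then have "same_segment (y i) (y j) \<or> same_segment (y i) (- y j)"
      using same_segment_iff[OF dimY unit[OF ij(1)], of "y j"] same_segment_iff[OF dimY unit[OF ij(1)], of "- y j"]
        unit[OF ij(2)] h by auto
    then show "same_segment (T (xpt i)) (T (xpt j)) \<or> same_segment (T (xpt i)) (- T (xpt j))"
      by (simp add: y_def)
  qed
  have "card N \<le> 4"
    using card_mono[OF _ N(1)] by simp
  have case4: "N = {}" if "card (S1 T) = 4"
  proof -
    have "card N = 0"
      using that card_S1 by linarith
    then show ?thesis
      using N(2) by simp
  qed
  \<comment> \<open>A nonsmooth image rules out the case of independent pairs, so a common
    functional exists.\<close>
  have few: "dim (span (JL T)) = 3 + min 3 (card N)" if "card N > 0"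
  proof -
    have "N \<noteq> {}"
      using that by auto
    then have common
      using pairs by blast
    then show ?thesis
      by (rule dim_common)
  qed
  have I: "k_smooth 3 T" if "card (S1 T) = 4" "dim (range T) = 1 \<or> ?seg"
  proof -
    have common
      using seg_common[OF _ case4[OF that(1)]] that(2) rank1 by blast
    then show ?thesis
      using dim_common case4[OF that(1)] by (simp add: k_smooth_def)
  qed
  have II: "k_smooth 4 T" if "card (S1 T) = 4" "\<not> (dim (range T) = 1 \<or> ?seg)"
  proof -
    have "\<not> common"
      using common_seg[OF _ case4[OF that(1)]] that(2) by blast
    then show ?thesis
      using pairs by (simp add: k_smooth_def)
  qed
  have III: "k_smooth 4 T" if "card (S1 T) = 3"
  proof -
    have "card N = 1"
      using that card_S1 by linarith
    then show ?thesis
      using few by (simp add: k_smooth_def)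
  qed
  have IV: "k_smooth 5 T" if "card (S1 T) = 2"
  proof -
    have "card N = 2"
      using that card_S1 by linarith
    then show ?thesis
      using few by (simp add: k_smooth_def)
  qed
  have V: "S1 T = {} \<and> k_smooth 6 T" if "card (S1 T) < 2"
  proof -
    have "card N = 4"
      using that card_S1 three \<open>card N \<le> 4\<close> by linarith
    then have "N = {1..4}"
      using N(1) by (intro card_subset_eq) auto
    then show ?thesis
      using few \<open>card N = 4\<close> by (simp add: k_smooth_def S1_eq)
  qed
  show ?thesis
    using I II III IV V by blast
qed

end
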